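(* Let $\mathcal{B}\subset\mathcal{B}(G)$ be a von Neumann algebra acting nondegenerately on a Hilbert space $G$, let $\vartheta$ be an $E_0$-semigroup on $\mathcal{B}$ and $\vartheta'$ an $E_0$-semigroup on $\mathcal{B}'$ (no continuity assumed). Then $\vartheta$ and $\vartheta'$ can be paired if and only if there exist a multiplier $m$ over $\mathbb{R}_+$ and an isomorphism modulo $m$ from the product system $E^\odot$ of $\vartheta$ onto the product system $F^\odot$ (the intertwiner system of $\vartheta'$, i.e. the commutant of the product system of $\vartheta'$).
   Context: An $E_0$-semigroup on a von Neumann algebra $\mathcal{C}$ is a family $(\theta_t)_{t\ge0}$ of normal unital $*$-endomorphisms of $\mathcal{C}$ with $\theta_0=\mathrm{id}$ and $\theta_{s+t}=\theta_s\circ\theta_t$. A pairing of an $E_0$-semigroup $\vartheta$ on $\mathcal{B}$ and an $E_0$-semigroup $\vartheta'$ on $\mathcal{B}'$ is a group $(\alpha_t)_{t\in\mathbb{R}}$ of $*$-automorphisms of $\mathcal{B}(G)$ ($\alpha_0=\mathrm{id}$, $\alpha_{s+t}=\alpha_s\circ\alpha_t$) such that $\alpha_{-t}(b)=\vartheta_t(b)$ and $\alpha_t(b')=\vartheta'_t(b')$ for all $t\ge0$, $b\in\mathcal{B}$, $b'\in\mathcal{B}'$; then $\vartheta,\vartheta'$ are said to be paired (via $\alpha$). A multiplier over $\mathbb{R}_+$ is a function $m:\mathbb{R}_+^2\to\mathbb{T}$ with $m(r,s)m(r+s,t)=m(r,s+t)m(s,t)$ for all $r,s,t\ge0$. The product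 system $E^\odot$ of $\vartheta$: for $t\ge0$, $E_t:=\mathcal{B}$ as a set, a $\mathcal{B}$-correspondence with right action by operator multiplication, inner product $\langle x,y\rangle=x^*y$, and left action $b.x:=\vartheta_t(b)x$; the product $E_s\times E_t\to E_{s+t}$ is $(x_s,y_t)\mapsto\vartheta_t(x_s)y_t$. The system $F^\odot$: $F_t:=\{y\in\mathcal{B}(G):\vartheta'_t(b')y=yb'\ \forall b'\in\mathcal{B}'\}$, a $\mathcal{B}$-correspondence with left and right actions of $\mathcal{B}$ by operator multiplication and inner product $\langle y,z\rangle=y^*z$; the product $F_s\times F_t\to F_{s+t}$ is $(y_s,z_t)\mapsto y_sz_t$ (operator product). Note $E_0=F_0=\mathcal{B}$. An isomorphism modulo $m$ from $E^\odot$ to $F^\odot$ is a family of surjective, inner-product-preserving, $\mathcal{B}$-bilinear maps $u_t:E_t\to F_t$ with $u_0=\mathrm{id}_{\mathcal{B}}$ and $u_{s+t}(\vartheta_t(x_s)\hat x_t)=u_s(x_s)\,u_t(\hat x_t)\,m(s,t)$ for all $s,t\ge0$, $x_s\in E_s$, $\hat x_t\in E_t$. *)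

theory Defs
  imports "HOL-Analysis.Analysis"
begin

text \<open>A complex Hilbert space G is modelled as a real Hilbert space (type class
real_inner + complete_space) together with an orthogonal complex structure J
(multiplication by i).  Bounded operators on G (the algebra B(G)) are the
bounded real-linear maps commuting with J, i.e. the bounded complex-linear maps.\<close>

type_synonym 'a op = "'a \<Rightarrow> 'a"

definition cstruct :: "('a::{real_inner,complete_space}) op \<Rightarrow> bool" where
  "cstruct J \<longleftrightarrow> linear J \<and> (\<forall>x. J (J x) = - x) \<and> (\<forall>x y. inner (J x) (J y) = inner x y)"

definition BG :: "('a::{real_inner,complete_space}) op \<Rightarrow> 'a op set" where
  "BG J = {T. bounded_linear T \<and> T \<circ> J = J \<circ> T}"

definition cscale :: "('a::{real_inner,complete_space}) op \<Rightarrow> complex \<Rightarrow> 'a op \<Rightarrow> 'a op" where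
  "cscale J c T = (\<lambda>x. Re c *\<^sub>R T x + Im c *\<^sub>R J (T x))"

definition oplus :: "('a::{real_inner,complete_space}) op \<Rightarrow> 'a op \<Rightarrow> 'a op" where
  "oplus S T = (\<lambda>x. S x + T x)"

text \<open>Adjoint (the real adjoint of a complex-linear operator coincides with its
complex adjoint).\<close>
definition adj :: "('a::{real_inner,complete_space}) op \<Rightarrow> 'a op" where
  "adj T = (THE S. \<forall>x y. inner (T x) y = inner x (S y))"

definition commutant :: "('a::{real_inner,complete_space}) op \<Rightarrow> 'a op set \<Rightarrow> 'a op set" where
  "commutant J S = {T \<in> BG J. \<forall>s\<in>S. T \<circ> s = s \<circ> T}"

definition von_neumann_algebra :: "('a::{real_inner,complete_space}) op \<Rightarrow> 'a op set \<Rightarrow> bool" where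
  "von_neumann_algebra J B \<longleftrightarrow> B \<subseteq> BG J \<and> (\<forall>b\<in>B. adj b \<in> B)
      \<and> B = commutant J (commutant J B)"

definition nondegenerate :: "('a::{real_inner,complete_space}) op set \<Rightarrow> bool" where
  "nondegenerate B \<longleftrightarrow> closure (span {b x | b x. b \<in> B}) = UNIV"

definition wot_tendsto :: "('i \<Rightarrow> ('a::{real_inner,complete_space}) op) \<Rightarrow> 'a op \<Rightarrow> 'i filter \<Rightarrow> bool" where
  "wot_tendsto f T F \<longleftrightarrow> (\<forall>x y. ((\<lambda>i. inner x (f i y)) \<longlongrightarrow> inner x (T y)) F)"

text \<open>Normality: weak-operator (equivalently sigma-weak) continuity on the unit ball.\<close>
definition normal_map :: "('a::{real_inner,complete_space}) op set \<Rightarrow> ('a op \<Rightarrow> 'a op) \<Rightarrow> bool" where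
  "normal_map A \<phi> \<longleftrightarrow> (\<forall>F T. T \<in> A \<longrightarrow> eventually (\<lambda>S. S \<in> A \<and> onorm S \<le> 1) F
      \<longrightarrow> wot_tendsto (\<lambda>S. S) T F \<longrightarrow> wot_tendsto \<phi> (\<phi> T) F)"

definition star_endo :: "('a::{real_inner,complete_space}) op \<Rightarrow> 'a op set \<Rightarrow> ('a op \<Rightarrow> 'a op) \<Rightarrow> bool" where
  "star_endo J A \<phi> \<longleftrightarrow> (\<forall>S\<in>A. \<phi> S \<in> A)
     \<and> (\<forall>S\<in>A. \<forall>T\<in>A. \<phi> (oplus S T) = oplus (\<phi> S) (\<phi> T))
     \<and> (\<forall>c. \<forall>S\<in>A. \<phi> (cscale J c S) = cscale J c (\<phi> S))
     \<and> (\<forall>S\<in>A. \<forall>T\<in>A. \<phi> (S \<circ> T) = \<phi> S \<circ> \<phi> T)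
     \<and> (\<forall>S\<in>A. \<phi> (adj S) = adj (\<phi> S))"

definition E0_semigroup :: "('a::{real_inner,complete_space}) op \<Rightarrow> 'a op set \<Rightarrow> (real \<Rightarrow> 'a op \<Rightarrow> 'a op) \<Rightarrow> bool" where
  "E0_semigroup J A \<theta> \<longleftrightarrow>
     (\<forall>t\<ge>0. star_endo J A (\<theta> t) \<and> normal_map A (\<theta> t) \<and> \<theta> t id = id)
     \<and> (\<forall>S\<in>A. \<theta> 0 S = S)
     \<and> (\<forall>s\<ge>0. \<forall>t\<ge>0. \<forall>S\<in>A. \<theta> (s + t) S = \<theta> s (\<theta> t S))"

definition automorphism_group :: "('a::{real_inner,complete_space}) op \<Rightarrow> (real \<Rightarrow> 'a op \<Rightarrow> 'a op) \<Rightarrow> bool" where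
  "automorphism_group J \<alpha> \<longleftrightarrow>
     (\<forall>t. star_endo J (BG J) (\<alpha> t) \<and> bij_betw (\<alpha> t) (BG J) (BG J))
     \<and> (\<forall>S\<in>BG J. \<alpha> 0 S = S)
     \<and> (\<forall>s t. \<forall>S\<in>BG J. \<alpha> (s + t) S = \<alpha> s (\<alpha> t S))"

definition paired :: "('a::{real_inner,complete_space}) op \<Rightarrow> 'a op set
    \<Rightarrow> (real \<Rightarrow> 'a op \<Rightarrow> 'a op) \<Rightarrow> (real \<Rightarrow> 'a op \<Rightarrow> 'a op) \<Rightarrow> bool" where
  "paired J B \<theta> \<theta>' \<longleftrightarrow> (\<exists>\<alpha>. automorphism_group J \<alpha> \<and>
     (\<forall>t\<ge>0. (\<forall>b\<in>B. \<alpha> (-t) b = \<theta> t b) \<and> (\<forall>b'\<in>commutant J B. \<alpha> t b' = \<theta>' t b')))"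

definition multiplier :: "(real \<Rightarrow> real \<Rightarrow> complex) \<Rightarrow> bool" where
  "multiplier m \<longleftrightarrow> (\<forall>s\<ge>0. \<forall>t\<ge>0. cmod (m s t) = 1)
     \<and> (\<forall>r\<ge>0. \<forall>s\<ge>0. \<forall>t\<ge>0. m r s * m (r + s) t = m r (s + t) * m s t)"

definition Ffib :: "('a::{real_inner,complete_space}) op \<Rightarrow> 'a op set \<Rightarrow> (real \<Rightarrow> 'a op \<Rightarrow> 'a op) \<Rightarrow> real \<Rightarrow> 'a op set" where
  "Ffib J B \<theta>' t = {y \<in> BG J. \<forall>b'\<in>commutant J B. \<theta>' t b' \<circ> y = y \<circ> b'}"

text \<open>Isomorphism modulo m from the product system E of \<theta> (fibres E_t = B, left
action b.x = \<theta>_t(b) x, product (x,y) \<mapsto> \<theta>_t(x) y) onto F.\<close>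
definition iso_mod :: "('a::{real_inner,complete_space}) op \<Rightarrow> 'a op set
    \<Rightarrow> (real \<Rightarrow> 'a op \<Rightarrow> 'a op) \<Rightarrow> (real \<Rightarrow> 'a op \<Rightarrow> 'a op)
    \<Rightarrow> (real \<Rightarrow> real \<Rightarrow> complex) \<Rightarrow> (real \<Rightarrow> 'a op \<Rightarrow> 'a op) \<Rightarrow> bool" where
  "iso_mod J B \<theta> \<theta>' m u \<longleftrightarrow>
     (\<forall>t\<ge>0. u t ` B = Ffib J B \<theta>' t
        \<and> (\<forall>x\<in>B. \<forall>y\<in>B. adj (u t x) \<circ> u t y = adj x \<circ> y)
        \<and> (\<forall>x\<in>B. \<forall>y\<in>B. u t (oplus x y) = oplus (u t x) (u t y))
        \<and> (\<forall>c. \<forall>x\<in>B. u t (cscale J c x) = cscale J c (u t x))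
        \<and> (\<forall>b\<in>B. \<forall>x\<in>B. u t (\<theta> t b \<circ> x) = b \<circ> u t x)
        \<and> (\<forall>b\<in>B. \<forall>x\<in>B. u t (x \<circ> b) = u t x \<circ> b))
     \<and> (\<forall>x\<in>B. u 0 x = x)
     \<and> (\<forall>s\<ge>0. \<forall>t\<ge>0. \<forall>x\<in>B. \<forall>y\<in>B.
          u (s + t) (\<theta> t x \<circ> y) = cscale J (m s t) (u s x \<circ> u t y))"

end

theory Submission
  imports Defs
begin

text \<open>
  A pairing \<alpha> is implemented by unitaries U_t, since every automorphism of B(G) is inner; these are
  unique up to a phase, so U_{s+t} = m(s,t) U_s U_t, and x \<mapsto> U_t x is the isomorphism.

  Conversely put U_t = u_t(1). This is an isometry with U_t \<theta>_t(b) = b U_t and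
  \<theta>'_t(b') U_t = U_t b', and every intertwiner from the identity representation of B' to \<theta>'_t is
  of the form U_t x. The point is that U_t is surjective; then \<alpha>_t = U_t . U_t^* is the pairing. The
  orthogonal complement L of the range of U_t is invariant under \<theta>'_t and receives no
  nonzero intertwiner, so the identity representation of B' and the restriction of \<theta>'_t to L are
  disjoint. By the bicommutant argument there are a in B', which may be taken self-adjoint,
  that are close to 0 on any given finite set of vectors of G while \<theta>'_t(a) is close to 1 on a
  given vector of L. The contractions a^2 / (1 + a^2) then tend weakly to 0 although their images
  under \<theta>'_t do not, which contradicts normality unless L = 0.
\<close>

section \<open>Orthogonal projections in finite powers of a Hilbert space\<close>

text \<open>Surjectivity of U_t is the obstacle because an isomorphism only provides F_t = U_t B,
  not that F_t G is dense in G. A unital endomorphism of B' that is not normal may have no nonzero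
  intertwiner with the identity representation at all: on the bounded sequences, take f to the
  constant omega(f) for a character omega vanishing on finitely supported sequences. Normality
  concerns the unit ball, whereas the density argument gives no bound on norms. A bounded function
  of a restores the bound, and this is why a must be self-adjoint. Since the self-adjoint elements
  form only a real vector space, all projections refer to the real inner product. The weak limit
  runs along a net because G need not be separable. The phases m(s,t) disappear under conjugation,
  so \<alpha> is a group although the U_t are multiplicative only up to phases.\<close>

text \<open>Elements of G^n are functions on a finite index set I; their values off I are irrelevant.\<close>

definition fibre_subspace :: "('i \<Rightarrow> 'a::real_vector) set \<Rightarrow> bool" where
  "fibre_subspace S \<longleftrightarrow> (\<lambda>i. 0) \<in> S \<and> (\<forall>x\<in>S. \<forall>y\<in>S. (\<lambda>i. x i + y i) \<in> S)
     \<and> (\<forall>c. \<forall>x\<in>S. (\<lambda>i. c *\<^sub>R x i) \<in> S)"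

definition seq_limits :: "'i set \<Rightarrow> ('i \<Rightarrow> 'a::topological_space) set \<Rightarrow> ('i \<Rightarrow> 'a) set" where
  "seq_limits I S = {w. \<exists>s. (\<forall>k::nat. s k \<in> S) \<and> (\<forall>i\<in>I. (\<lambda>k. s k i) \<longlonglongrightarrow> w i)}"

text \<open>S need not be closed: \<open>w\<close> is a limit of S, while the residual is tested on
  S itself. On I this determines the orthogonal projection onto the closure of S, for the real inner
  product.\<close>

definition is_proj :: "'i set \<Rightarrow> ('i \<Rightarrow> 'a::real_inner) set \<Rightarrow> ('i \<Rightarrow> 'a) \<Rightarrow> ('i \<Rightarrow> 'a) \<Rightarrow> bool" where
  "is_proj I S v w \<longleftrightarrow> w \<in> seq_limits I S \<and> (\<forall>z\<in>S. (\<Sum>i\<in>I. inner (v i - w i) (z i)) = 0)"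

lemma quadratic_nonneg_imp_linear_zero:
  fixes a b :: real
  assumes "\<And>t. 0 \<le> t\<^sup>2 * b - 2 * t * a"
  shows "a = 0"
proof (cases "b = 0")
  case True
  then show ?thesis using assms[of a] by (simp add: power2_eq_square)
       (metis mult_eq_0_iff mult_le_0_iff not_square_less_zero order_antisym_conv linorder_not_le)
next
  case False
  have "0 \<le> b - 2 * a" "0 \<le> b + 2 * a" using assms[of 1] assms[of "-1"] by auto
  with False have "b > 0" by linarith
  \<comment> \<open>The quadratic is smallest at t = a / b.\<close>
  have "0 \<le> (a / b)\<^sup>2 * b - 2 * (a / b) * a" by (rule assms)
  also have "\<dots> = - (a\<^sup>2 / b)" using \<open>b > 0\<close> by (simp add: field_simps power2_eq_square)
  finally have "a\<^sup>2 / b \<le> 0" by simp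
  with \<open>b > 0\<close> show ?thesis by (simp add: divide_le_0_iff)
qed

text \<open>The parallelogram law makes a minimising sequence Cauchy; orthogonality is the vanishing
  of the first variation of the squared distance at its limit.\<close>

lemma is_proj_exists:
  fixes S :: "('i \<Rightarrow> 'a::{real_inner,complete_space}) set" and v :: "'i \<Rightarrow> 'a"
  assumes I: "finite I" and S: "fibre_subspace S"
  shows "\<exists>w. is_proj I S v w"
proof -
  define n where "n z = (\<Sum>i\<in>I. (norm (v i - z i))\<^sup>2)" for z
  define d where "d = Inf (n ` S)"
  have n0: "0 \<le> n z" for z by (simp add: n_def sum_nonneg)
  have bdd: "bdd_below (n ` S)" using n0 by (auto simp: bdd_below_def)
  have ne: "n ` S \<noteq> {}" using S by (auto simp: fibre_subspace_def)
  have d_le: "d \<le> n z" if "z \<in> S" for z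
    unfolding d_def by (rule cInf_lower) (use that bdd in auto)
  have "\<exists>z\<in>S. n z < d + 1 / real (Suc k)" for k
    using cInf_lessD[OF ne, of "d + 1 / real (Suc k)"] by (auto simp: d_def)
  then obtain s where s: "\<And>k. s k \<in> S" "\<And>k. n (s k) < d + 1 / real (Suc k)" by metis
  have par: "(\<Sum>i\<in>I. (norm (s k i - s l i))\<^sup>2) \<le> 2 / real (Suc k) + 2 / real (Suc l)" for k l
  proof -
    have mid: "(\<lambda>i. (1/2) *\<^sub>R (s k i + s l i)) \<in> S"
      using S s(1) unfolding fibre_subspace_def by fast
    \<comment> \<open>Parallelogram law for u - x and u - y. The midpoint stays in S, so its
      distance to v is at least the infimum.\<close>
    have pt: "(norm (x - y))\<^sup>2 = 2 * (norm (u - x))\<^sup>2 + 2 * (norm (u - y))\<^sup>2 - 4 * (norm (u - (1/2) *\<^sub>R (x + y)))\<^sup>2"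
      for x y u :: 'a
      by (simp add: power2_norm_eq_inner inner_simps inner_commute algebra_simps)
    have "(\<Sum>i\<in>I. (norm (s k i - s l i))\<^sup>2)
        = 2 * n (s k) + 2 * n (s l) - 4 * n (\<lambda>i. (1/2) *\<^sub>R (s k i + s l i))"
      unfolding n_def sum_distrib_left sum_subtractf[symmetric] sum.distrib[symmetric]
      by (intro sum.cong refl pt)
    then show ?thesis using d_le[OF mid] s(2)[of k] s(2)[of l] by simp
  qed
  have "\<exists>x. (\<lambda>k. s k i) \<longlonglongrightarrow> x" if "i \<in> I" for i
  proof -
    have "Cauchy (\<lambda>k. s k i)"
    proof (rule metric_CauchyI)
      fix e :: real assume "0 < e"
      then obtain K where K: "4 / real (Suc K) < e\<^sup>2"
        using reals_Archimedean[of "e\<^sup>2 / 4"] by (auto simp: field_simps)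
      show "\<exists>M. \<forall>m\<ge>M. \<forall>n\<ge>M. dist (s m i) (s n i) < e"
      proof (intro exI allI impI)
        fix k l assume kl: "K \<le> k" "K \<le> l"
        have "(norm (s k i - s l i))\<^sup>2 \<le> (\<Sum>i\<in>I. (norm (s k i - s l i))\<^sup>2)"
          by (rule member_le_sum) (use that I in auto)
        also have "\<dots> \<le> 2 / real (Suc k) + 2 / real (Suc l)" by (rule par)
        also have "\<dots> \<le> 2 / real (Suc K) + 2 / real (Suc K)"
          by (intro add_mono divide_left_mono) (use kl in auto)
        also have "\<dots> < e\<^sup>2" using K by simp
        finally show "dist (s k i) (s l i) < e"
          using \<open>0 < e\<close> by (simp add: dist_norm power2_less_imp_less)
      qed
    qed
    then show ?thesis by (simp add: Cauchy_convergent_iff convergent_def)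
  qed
  then obtain w where w: "\<And>i. i \<in> I \<Longrightarrow> (\<lambda>k. s k i) \<longlonglongrightarrow> w i" by metis
  have lim: "(\<lambda>k. n (\<lambda>i. s k i + t *\<^sub>R z i)) \<longlonglongrightarrow> n (\<lambda>i. w i + t *\<^sub>R z i)" for t z
    unfolding n_def by (intro tendsto_intros w)
  have nw: "n w \<le> d"
  proof -
    have 1: "(\<lambda>k. d + 1 / real (Suc k)) \<longlonglongrightarrow> d + 0"
      by (intro tendsto_add tendsto_const LIMSEQ_Suc[OF lim_1_over_n])
    have 2: "(\<lambda>k. n (s k)) \<longlonglongrightarrow> n w" using lim[of 0 "\<lambda>_. 0"] by simp
    show ?thesis using LIMSEQ_le[OF 2 1] s(2) by (metis add.right_neutral less_imp_le)
  qed
  have "(\<Sum>i\<in>I. inner (v i - w i) (z i)) = 0" if z: "z \<in> S" for z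
  proof (rule quadratic_nonneg_imp_linear_zero)
    fix t :: real
    have "(\<lambda>i. s k i + t *\<^sub>R z i) \<in> S" for k
      using S s(1) z unfolding fibre_subspace_def by fast
    then have "d \<le> n (\<lambda>i. s k i + t *\<^sub>R z i)" for k by (rule d_le)
    then have "d \<le> n (\<lambda>i. w i + t *\<^sub>R z i)"
      by (intro LIMSEQ_le_const[OF lim]) auto
    also have "\<dots> = n w + (t\<^sup>2 * (\<Sum>i\<in>I. inner (z i) (z i)) - 2 * t * (\<Sum>i\<in>I. inner (v i - w i) (z i)))"
      unfolding n_def sum_distrib_left sum_subtractf[symmetric] sum.distrib[symmetric]
      by (intro sum.cong refl)
         (simp add: power2_norm_eq_inner inner_simps inner_commute algebra_simps power2_eq_square[of t])
    finally show "0 \<le> t\<^sup>2 * (\<Sum>i\<in>I. inner (z i) (z i)) - 2 * t * (\<Sum>i\<in>I. inner (v i - w i) (z i))"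
      using nw by linarith
  qed
  then show ?thesis using s(1) w unfolding is_proj_def seq_limits_def by blast
qed

lemma is_proj_orthogonal:
  assumes "is_proj I S v w" "z \<in> seq_limits I S"
  shows "(\<Sum>i\<in>I. inner (v i - w i) (z i)) = 0"
proof -
  from assms(2) obtain s where s: "\<And>k. s k \<in> S" "\<And>i. i \<in> I \<Longrightarrow> (\<lambda>k. s k i) \<longlonglongrightarrow> z i"
    unfolding seq_limits_def by blast
  have "(\<lambda>k. \<Sum>i\<in>I. inner (v i - w i) (s k i)) \<longlonglongrightarrow> (\<Sum>i\<in>I. inner (v i - w i) (z i))"
    by (intro tendsto_intros s)
  moreover have "(\<Sum>i\<in>I. inner (v i - w i) (s k i)) = 0" for k
    using assms(1) s(1) by (auto simp: is_proj_def)
  ultimately show ?thesis by (simp add: LIMSEQ_const_iff)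
qed

lemma sum_inner_self_eq_0:
  assumes "finite I" "(\<Sum>i\<in>I. inner (x i) (x i)) = 0" "i \<in> I"
  shows "x i = 0"
  using assms by (simp add: sum_nonneg_eq_0_iff)

lemma is_proj_unique:
  assumes I: "finite I" and "is_proj I S v w" "is_proj I S v w'" "i \<in> I"
  shows "w i = w' i"
proof -
  have lim: "w \<in> seq_limits I S" "w' \<in> seq_limits I S"
    using assms(2,3) by (auto simp: is_proj_def)
  \<comment> \<open>w - w' is a difference of two residuals, each of which is orthogonal to both w
    and w'.\<close>
  have "(\<Sum>i\<in>I. inner (w i - w' i) (w i - w' i))
     = (\<Sum>i\<in>I. inner (v i - w' i) (w i)) - (\<Sum>i\<in>I. inner (v i - w i) (w i))
     - ((\<Sum>i\<in>I. inner (v i - w' i) (w' i)) - (\<Sum>i\<in>I. inner (v i - w i) (w' i)))"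
    unfolding sum_subtractf[symmetric] by (intro sum.cong refl) (simp add: inner_simps)
  also have "\<dots> = 0" using assms(2,3) lim by (simp add: is_proj_orthogonal)
  finally show ?thesis using sum_inner_self_eq_0[OF I, of "\<lambda>i. w i - w' i"] assms(4) by simp
qed

lemma is_proj_add:
  assumes S: "fibre_subspace S" and "is_proj I S v w" "is_proj I S v' w'"
  shows "is_proj I S (\<lambda>i. v i + v' i) (\<lambda>i. w i + w' i)"
proof -
  obtain s s' where s: "\<And>k. s k \<in> S" "\<And>i. i \<in> I \<Longrightarrow> (\<lambda>k. s k i) \<longlonglongrightarrow> w i"
     and s': "\<And>k. s' k \<in> S" "\<And>i. i \<in> I \<Longrightarrow> (\<lambda>k. s' k i) \<longlonglongrightarrow> w' i"
    using assms unfolding is_proj_def seq_limits_def by blast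
  have "(\<lambda>i. s k i + s' k i) \<in> S" for k using S s s' unfolding fibre_subspace_def by fast
  moreover have "(\<lambda>k. s k i + s' k i) \<longlonglongrightarrow> w i + w' i" if "i \<in> I" for i
    by (intro tendsto_intros s s' that)
  ultimately have "(\<lambda>i. w i + w' i) \<in> seq_limits I S"
    unfolding seq_limits_def by (auto intro!: exI[of _ "\<lambda>k i. s k i + s' k i"])
  moreover have "(\<Sum>i\<in>I. inner (v i + v' i - (w i + w' i)) (z i)) = 0" if "z \<in> S" for z
  proof -
    have "(\<Sum>i\<in>I. inner (v i + v' i - (w i + w' i)) (z i))
      = (\<Sum>i\<in>I. inner (v i - w i) (z i)) + (\<Sum>i\<in>I. inner (v' i - w' i) (z i))"
      unfolding sum.distrib[symmetric] by (intro sum.cong refl) (simp add: inner_simps)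
    then show ?thesis using assms that by (simp add: is_proj_def)
  qed
  ultimately show ?thesis by (simp add: is_proj_def)
qed

text \<open>A subspace preserved by an operator and its adjoint is reducing, so its projection
  commutes with the operator. The operator is diagonal and may differ from coordinate to coordinate,
  as the action of an algebra on a direct sum of different representations does.\<close>

lemma is_proj_map:
  assumes "is_proj I S v w"
    and bl: "\<And>i. i \<in> I \<Longrightarrow> bounded_linear (A i)"
    and adj: "\<And>i x y. i \<in> I \<Longrightarrow> inner (A i x) y = inner x (A' i y)"
    and S: "\<And>z. z \<in> S \<Longrightarrow> (\<lambda>i. A i (z i)) \<in> S" "\<And>z. z \<in> S \<Longrightarrow> (\<lambda>i. A' i (z i)) \<in> S"
  shows "is_proj I S (\<lambda>i. A i (v i)) (\<lambda>i. A i (w i))"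
proof -
  obtain s where s: "\<And>k. s k \<in> S" "\<And>i. i \<in> I \<Longrightarrow> (\<lambda>k. s k i) \<longlonglongrightarrow> w i"
    using assms unfolding is_proj_def seq_limits_def by blast
  have "(\<lambda>k. A i (s k i)) \<longlonglongrightarrow> A i (w i)" if "i \<in> I" for i
    using bounded_linear.tendsto[OF bl s(2)] that by blast
  then have "(\<lambda>i. A i (w i)) \<in> seq_limits I S"
    unfolding seq_limits_def using S(1)[OF s(1)]
    by (auto intro!: exI[of _ "\<lambda>k i. A i (s k i)"])
  moreover have "(\<Sum>i\<in>I. inner (A i (v i) - A i (w i)) (z i)) = 0" if "z \<in> S" for z
  proof -
    have "(\<Sum>i\<in>I. inner (A i (v i) - A i (w i)) (z i)) = (\<Sum>i\<in>I. inner (v i - w i) (A' i (z i)))"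
      by (intro sum.cong refl) (metis adj bl bounded_linear.linear linear_diff)
    also have "\<dots> = 0" using assms(1) S(2)[OF that] by (simp add: is_proj_def)
    finally show ?thesis .
  qed
  ultimately show ?thesis by (simp add: is_proj_def)
qed

lemma is_proj_norm:
  assumes I: "finite I" and "is_proj I S v w" "i \<in> I"
  shows "(norm (w i))\<^sup>2 \<le> (\<Sum>i\<in>I. (norm (v i))\<^sup>2)"
proof -
  have "w \<in> seq_limits I S" using assms by (simp add: is_proj_def)
  then have "(\<Sum>i\<in>I. inner (v i - w i) (w i)) = 0" using assms is_proj_orthogonal by blast
  have "(norm (w i))\<^sup>2 \<le> (\<Sum>i\<in>I. (norm (w i))\<^sup>2)"
    by (rule member_le_sum) (use assms in auto)
  also have "\<dots> \<le> (\<Sum>i\<in>I. (norm (w i))\<^sup>2) + (\<Sum>i\<in>I. (norm (v i - w i))\<^sup>2)"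
    by (simp add: sum_nonneg)
  also have "\<dots> = (\<Sum>i\<in>I. (norm (v i))\<^sup>2) - 2 * (\<Sum>i\<in>I. inner (v i - w i) (w i))"
    unfolding sum_distrib_left sum.distrib[symmetric] sum_subtractf[symmetric]
    by (intro sum.cong refl) (simp add: power2_norm_eq_inner inner_simps inner_commute)
  also have "\<dots> = (\<Sum>i\<in>I. (norm (v i))\<^sup>2)"
    using \<open>(\<Sum>i\<in>I. inner (v i - w i) (w i)) = 0\<close> by simp
  finally show ?thesis .
qed

lemma closed_subspace_orthogonal_decomp:
  fixes N :: "'a::{real_inner,complete_space} set"
  assumes "subspace N" "closed N"
  shows "\<exists>w\<in>N. \<forall>z\<in>N. inner (v - w) z = 0"
proof -
  \<comment> \<open>A single coordinate, indexed by \<open>()\<close>, gives the usual projection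
    theorem in G.\<close>
  let ?S = "(\<lambda>x (_::unit). x) ` N"
  have "fibre_subspace ?S"
    using assms(1) by (auto simp: fibre_subspace_def subspace_def image_iff fun_eq_iff)
  then obtain w where w: "is_proj {()} ?S (\<lambda>_. v) w" using is_proj_exists[of "{()}" ?S] by blast
  have "w () \<in> N"
  proof -
    obtain s where s: "\<And>k. s k \<in> ?S" "(\<lambda>k. s k ()) \<longlonglongrightarrow> w ()"
      using w unfolding is_proj_def seq_limits_def by blast
    have "s k () \<in> N" for k using s(1)[of k] by auto
    then show ?thesis using closed_sequentially[OF assms(2) _ s(2)] by blast
  qed
  then show ?thesis using w by (auto simp: is_proj_def)
qed

section \<open>Adjoints\<close>

lemma riesz_representation:
  fixes f :: "'a::{real_inner,complete_space} \<Rightarrow> real"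
  assumes f: "bounded_linear f"
  shows "\<exists>r. \<forall>x. f x = inner x r"
proof (cases "\<forall>x. f x = 0")
  case True
  then show ?thesis by (auto intro: exI[of _ 0])
next
  case False
  interpret f: bounded_linear f by (rule f)
  from False obtain v where v: "f v \<noteq> 0" by blast
  let ?N = "{x. f x = 0}"
  have "subspace ?N" by (auto simp: subspace_def f.add f.scaleR f.zero)
  moreover have "closed ?N" by (intro closed_Collect_eq continuous_intros f.continuous_on)
  ultimately obtain w where w: "f w = 0" "\<And>z. f z = 0 \<Longrightarrow> inner (v - w) z = 0"
    using closed_subspace_orthogonal_decomp[of ?N v] by blast
  \<comment> \<open>The kernel of f is a hyperplane, so this residual spans its orthogonal
    complement.\<close>
  define r where "r = v - w"
  have fr: "f r = f v" using w by (simp add: r_def f.diff)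
  then have "r \<noteq> 0" using v by (auto simp: f.zero)
  have "f x = inner x ((f r / inner r r) *\<^sub>R r)" for x
  proof -
    have "f (x - (f x / f r) *\<^sub>R r) = 0" using v fr by (simp add: f.diff f.scaleR)
    then have "inner r (x - (f x / f r) *\<^sub>R r) = 0" using w(2) by (simp add: r_def)
    then have "inner r x = (f x / f r) * inner r r" by (simp add: inner_simps)
    then show ?thesis using \<open>r \<noteq> 0\<close> v fr by (simp add: inner_commute)
  qed
  then show ?thesis by blast
qed

lemma adj_eqI:
  assumes "\<And>x y. inner (T x) y = inner x (S y)"
  shows "adj T = S"
  unfolding adj_def
proof (rule the_equality)
  fix S' assume "\<forall>x y. inner (T x) y = inner x (S' y)"
  then have "inner x (S' y) = inner x (S y)" for x y using assms by metis
  then show "S' = S" by (intro ext) (metis vector_eq_rdot inner_commute)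
qed (use assms in blast)

lemma inner_adj:
  assumes T: "bounded_linear T"
  shows "inner (T x) y = inner x (adj T y)"
proof -
  have "bounded_linear (\<lambda>x. inner (T x) y)" for y
    by (rule bounded_linear_compose[OF bounded_linear_inner_left T])
  then have "\<exists>r. \<forall>x. inner (T x) y = inner x r" for y by (rule riesz_representation)
  then obtain S where "\<And>x y. inner (T x) y = inner x (S y)" by metis
  then show ?thesis using adj_eqI by metis
qed

lemma inner_adj':
  assumes T: "bounded_linear T"
  shows "inner (adj T x) y = inner x (T y)"
  by (metis assms inner_adj inner_commute)

lemma bounded_linear_adj:
  assumes T: "bounded_linear T"
  shows "bounded_linear (adj T)"
proof -
  obtain K where K: "\<And>x. norm (T x) \<le> norm x * K"
    using bounded_linear.bounded[OF T] by blast
  have eq: "x = y" if "\<And>z. inner z x = inner z y" for x y :: 'a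
    using that by (metis vector_eq_rdot inner_commute)
  show ?thesis
  proof (rule bounded_linear_intro)
    show "adj T (x + y) = adj T x + adj T y" for x y
      by (rule eq) (simp add: inner_add_right inner_adj[OF T, symmetric])
    show "adj T (r *\<^sub>R x) = r *\<^sub>R adj T x" for r x
      by (rule eq) (simp add: inner_adj[OF T, symmetric])
    show "norm (adj T y) \<le> norm y * K" for y
    proof (cases "adj T y = 0")
      case True
      have "0 \<le> norm y * K" using K[of y] norm_ge_zero order_trans by blast
      then show ?thesis by (simp add: True)
    next
      case False
      have "(norm (adj T y))\<^sup>2 = inner (T (adj T y)) y"
        by (simp add: inner_adj[OF T] power2_norm_eq_inner)
      also have "\<dots> \<le> norm (T (adj T y)) * norm y" by (rule norm_cauchy_schwarz)
      also have "\<dots> \<le> norm (adj T y) * K * norm y" by (intro mult_right_mono K) auto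
      finally show ?thesis using False by (simp add: power2_eq_square mult_ac)
    qed
  qed
qed

lemma adj_adj: "bounded_linear T \<Longrightarrow> adj (adj T) = T"
  by (rule adj_eqI) (simp add: inner_adj')

lemma adj_comp:
  assumes "bounded_linear S" "bounded_linear T"
  shows "adj (S \<circ> T) = adj T \<circ> adj S"
  by (rule adj_eqI) (simp add: inner_adj assms)

lemma adj_oplus:
  assumes "bounded_linear S" "bounded_linear T"
  shows "adj (oplus S T) = oplus (adj S) (adj T)"
  by (rule adj_eqI) (simp add: oplus_def inner_simps inner_adj assms)

lemma adj_id: "adj id = id"
  by (rule adj_eqI) simp

section \<open>Bounded complex-linear operators\<close>

lemma BG_iff: "T \<in> BG J \<longleftrightarrow> bounded_linear T \<and> (\<forall>x. T (J x) = J (T x))"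
  by (auto simp: BG_def fun_eq_iff)

lemma BG_bounded_linear: "T \<in> BG J \<Longrightarrow> bounded_linear T"
  by (simp add: BG_iff)

lemma cstruct_bounded_linear:
  assumes "cstruct J"
  shows "bounded_linear J"
proof -
  have "norm (J x) \<le> norm x * 1" for x
    using assms by (simp add: cstruct_def norm_eq_sqrt_inner)
  with assms show ?thesis
    unfolding cstruct_def by (intro bounded_linear_intro[where K = 1]) (auto simp: linear_add linear_scale)
qed

lemma cstruct_inner:
  assumes "cstruct J"
  shows "inner (J x) y = - inner x (J y)"
proof -
  have "inner (J x) (J (J y)) = inner x (J y)" "J (J y) = - y"
    using assms unfolding cstruct_def by blast+
  then show ?thesis by simp
qed

lemma adj_in_BG:
  assumes J: "cstruct J" and T: "T \<in> BG J"
  shows "adj T \<in> BG J"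
proof -
  have bl: "bounded_linear T" and comm: "\<And>x. T (J x) = J (T x)" using T by (auto simp: BG_iff)
  have "inner (adj T (J y)) x = inner (J (adj T y)) x" for x y
    by (simp add: inner_adj'[OF bl] cstruct_inner[OF J] comm)
  then have "adj T (J y) = J (adj T y)" for y by (metis vector_eq_rdot inner_commute)
  with bl show ?thesis by (simp add: BG_iff bounded_linear_adj)
qed

lemma id_in_BG: "id \<in> BG J"
  by (simp add: BG_iff id_def bounded_linear_ident)

lemma oplus_in_BG: "cstruct J \<Longrightarrow> S \<in> BG J \<Longrightarrow> T \<in> BG J \<Longrightarrow> oplus S T \<in> BG J"
  by (auto simp: BG_iff oplus_def bounded_linear_add linear_add cstruct_def)

lemma cscale_in_BG:
  assumes J: "cstruct J" and T: "T \<in> BG J"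
  shows "cscale J c T \<in> BG J"
proof -
  have "bounded_linear (\<lambda>x. Re c *\<^sub>R T x + Im c *\<^sub>R J (T x))"
    by (intro bounded_linear_add bounded_linear_compose[OF bounded_linear_scaleR_right]
        bounded_linear_compose[OF cstruct_bounded_linear[OF J]] BG_bounded_linear[OF T])
  then show ?thesis using J T
    by (simp add: BG_iff cscale_def cstruct_def linear_add linear_scale)
qed

lemma comp_in_BG: "S \<in> BG J \<Longrightarrow> T \<in> BG J \<Longrightarrow> S \<circ> T \<in> BG J"
  using bounded_linear_compose by (auto simp: BG_iff comp_def)

lemma commutant_iff:
  "T \<in> commutant J S \<longleftrightarrow> T \<in> BG J \<and> (\<forall>s\<in>S. \<forall>x. T (s x) = s (T x))"
  by (auto simp: commutant_def fun_eq_iff)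

lemma commutant_subset_BG: "commutant J S \<subseteq> BG J"
  by (auto simp: commutant_def)

lemma id_in_commutant: "id \<in> commutant J S"
  by (simp add: commutant_iff id_in_BG)

lemma comp_in_commutant: "a \<in> commutant J S \<Longrightarrow> b \<in> commutant J S \<Longrightarrow> a \<circ> b \<in> commutant J S"
  by (simp add: commutant_iff comp_in_BG)

lemma oplus_in_commutant:
  assumes "cstruct J" "S \<subseteq> BG J" "a \<in> commutant J S" "b \<in> commutant J S"
  shows "oplus a b \<in> commutant J S"
  using assms by (auto simp: commutant_iff oplus_in_BG)
    (auto simp: oplus_def BG_iff bounded_linear.linear linear_add)

lemma cscale_in_commutant:
  assumes "cstruct J" "S \<subseteq> BG J" "a \<in> commutant J S"
  shows "cscale J c a \<in> commutant J S"
proof -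
  have "s (Re c *\<^sub>R y + Im c *\<^sub>R J y) = Re c *\<^sub>R s y + Im c *\<^sub>R J (s y)" if "s \<in> S" for s y
  proof -
    have "linear s" "\<And>x. s (J x) = J (s x)"
      using that assms by (auto simp: BG_iff bounded_linear.linear)
    then show ?thesis by (simp add: linear_add linear_scale)
  qed
  then show ?thesis using assms by (auto simp: commutant_iff cscale_in_BG) (auto simp: cscale_def)
qed

lemma adj_in_commutant:
  assumes J: "cstruct J" and S: "S \<subseteq> BG J" "\<And>s. s \<in> S \<Longrightarrow> adj s \<in> S" and a: "a \<in> commutant J S"
  shows "adj a \<in> commutant J S"
proof -
  have aB: "a \<in> BG J" using a by (simp add: commutant_iff)
  have "adj a (s x) = s (adj a x)" if s: "s \<in> S" for s x
  proof -
    have bl: "bounded_linear s" "bounded_linear a"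
      using s S aB by (auto simp: BG_iff)
    have "inner (adj a (s x)) y = inner (s (adj a x)) y" for y
    proof -
      have "inner (adj a (s x)) y = inner x (adj s (a y))"
        by (simp add: inner_adj'[OF bl(2)] inner_adj[OF bl(1)])
      also have "\<dots> = inner x (a (adj s y))" using a S(2)[OF s] by (simp add: commutant_iff)
      also have "\<dots> = inner (s (adj a x)) y"
        by (simp add: inner_adj'[OF bl(2)] inner_adj[OF bl(1)])
      finally show ?thesis .
    qed
    then show ?thesis by (metis vector_eq_rdot inner_commute)
  qed
  then show ?thesis by (simp add: commutant_iff adj_in_BG[OF J aB])
qed

text \<open>R is the inverse of 1 + a^2, which is injective because a^2 is positive. Surjectivity
  comes from projecting onto the graph of a, without a spectral theorem.\<close>

lemma resolvent_exists:
  assumes J: "cstruct J" and S: "S \<subseteq> BG J" and a: "a \<in> commutant J S" and sa: "adj a = a"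
  shows "\<exists>R \<in> commutant J S. (\<forall>y. R y + a (a (R y)) = y) \<and> adj R = R"
proof -
  have aB: "a \<in> BG J" using a by (simp add: commutant_iff)
  then interpret a: bounded_linear a by (simp add: BG_iff)
  have sym: "inner (a x) y = inner x (a y)" for x y
    using inner_adj[OF a.bounded_linear_axioms] sa by simp
  have uniq: "x = y" if "x + a (a x) = y + a (a y)" for x y
  proof -
    have "(x - y) + a (a (x - y)) = 0" using that by (simp add: a.diff algebra_simps)
    then have "inner (x - y) (x - y) + inner (a (x - y)) (a (x - y)) = 0"
      by (metis sym inner_add_left inner_zero_left)
    then have "inner (x - y) (x - y) = 0"
      by (metis inner_ge_zero add_nonneg_eq_0_iff)
    then show ?thesis by simp
  qed
  have "\<exists>x. x + a (a x) = y" for y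
  proof -
    \<comment> \<open>The graph of a, with \<open>True\<close> for the first component. The residual
      of (y, 0) is orthogonal to all (z, a z), which says y = w + a (a w) for the first component w
      of the projection.\<close>
    let ?S = "range (\<lambda>z i. if i then z else a z)"
    have "fibre_subspace ?S"
      unfolding fibre_subspace_def
      by (auto simp: image_iff fun_eq_iff a.zero a.add a.scaleR
          intro: exI[of _ "0::'a"] exI[of _ "x + y" for x y :: 'a] exI[of _ "c *\<^sub>R x" for c and x :: 'a])
    then obtain w where w: "is_proj UNIV ?S (\<lambda>i. if i then y else 0) w"
      using is_proj_exists[of UNIV ?S] by auto
    then obtain s where s: "\<And>k. s k \<in> ?S" "\<And>i. (\<lambda>k. s k i) \<longlonglongrightarrow> w i"
      unfolding is_proj_def seq_limits_def by auto
    have "s k False = a (s k True)" for k using s(1)[of k] by auto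
    then have "w False = a (w True)"
      using a.tendsto[OF s(2)[of True]] s(2)[of False] LIMSEQ_unique by fastforce
    moreover have "inner (y - w True) z - inner (w False) (a z) = 0" for z
      using w unfolding is_proj_def UNIV_bool by force
    ultimately have "inner (y - (w True + a (a (w True)))) z = 0" for z
      by (simp add: sym inner_simps) (metis add.commute add_diff_eq diff_add_cancel)
    then have "y - (w True + a (a (w True))) = 0" by (metis inner_eq_zero_iff)
    then show ?thesis by (auto intro!: exI[of _ "w True"])
  qed
  then obtain R where R: "\<And>y. R y + a (a (R y)) = y" by metis
  \<comment> \<open>By uniqueness of the solution, linearity of R and its commutation with whatever
    commutes with a reduce to checking one equation.\<close>
  have ReqI: "R y = x" if "x + a (a x) = y" for x y
    by (rule uniq) (simp add: R that)
  have "bounded_linear R"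
  proof (rule bounded_linear_intro[where K = 1])
    show "R (x + y) = R x + R y" for x y
      by (rule ReqI) (metis (no_types, lifting) R a.add add.assoc add.left_commute)
    show "R (c *\<^sub>R x) = c *\<^sub>R R x" for c x
      by (rule ReqI) (metis (no_types, lifting) R a.scaleR scaleR_add_right)
    fix x
    have "(norm (R x))\<^sup>2 \<le> inner (R x) (R x) + inner (a (R x)) (a (R x))"
      by (simp add: power2_norm_eq_inner)
    also have "\<dots> = inner (R x) x" by (metis R inner_add_right sym)
    also have "\<dots> \<le> norm (R x) * norm x" by (rule norm_cauchy_schwarz)
    finally show "norm (R x) \<le> norm x * 1"
      by (cases "R x = 0") (auto simp: power2_eq_square)
  qed
  moreover have "R (s x) = s (R x)"
    if "bounded_linear s" "\<And>x. a (s x) = s (a x)" for s x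
    by (rule ReqI) (metis R that bounded_linear.linear linear_add)
  ultimately have "R \<in> commutant J S"
    using a S J by (auto simp: commutant_iff BG_iff subset_iff cstruct_bounded_linear)
  moreover have "adj R = R"
  proof (rule adj_eqI)
    fix x y
    have "inner (R x) y = inner (R x) (R y + a (a (R y)))" by (simp add: R)
    also have "\<dots> = inner (R x + a (a (R x))) (R y)" by (simp add: inner_simps sym)
    finally show "inner (R x) y = inner x (R y)" by (simp add: R)
  qed
  ultimately show ?thesis using R by blast
qed

section \<open>Intertwiners of normal representations\<close>

text \<open>\<rho> is one map \<theta>'_t at a fixed time, regarded as a second representation of B'
  on G beside the identity representation.\<close>

locale normal_rep =
  fixes J :: "'a::{real_inner,complete_space} op" and B :: "'a op set" and \<rho> :: "'a op \<Rightarrow> 'a op"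
  assumes J: "cstruct J" and B: "B \<subseteq> BG J" and adj_B: "\<And>b. b \<in> B \<Longrightarrow> adj b \<in> B"
    and star_endo: "star_endo J (commutant J B) \<rho>"
    and normal: "normal_map (commutant J B) \<rho>"
    and unital: "\<rho> id = id"
begin

abbreviation "M \<equiv> commutant J B"

lemma M_bounded_linear: "a \<in> M \<Longrightarrow> bounded_linear a"
  by (simp add: commutant_iff BG_iff)

lemma adj_M: "a \<in> M \<Longrightarrow> adj a \<in> M"
  using adj_in_commutant[OF J B adj_B] by blast

lemmas oplus_M = oplus_in_commutant[OF J B]
lemmas cscale_M = cscale_in_commutant[OF J B]

lemma rho_M: "a \<in> M \<Longrightarrow> \<rho> a \<in> M"
  using star_endo by (simp add: star_endo_def)

lemma rho_oplus: "a \<in> M \<Longrightarrow> b \<in> M \<Longrightarrow> \<rho> (oplus a b) x = \<rho> a x + \<rho> b x"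
  using star_endo by (simp add: star_endo_def oplus_def)

lemma rho_cscale: "a \<in> M \<Longrightarrow> \<rho> (cscale J c a) x = Re c *\<^sub>R \<rho> a x + Im c *\<^sub>R J (\<rho> a x)"
  using star_endo by (simp add: star_endo_def cscale_def)

lemma rho_comp: "a \<in> M \<Longrightarrow> b \<in> M \<Longrightarrow> \<rho> (a \<circ> b) x = \<rho> a (\<rho> b x)"
  using star_endo by (simp add: star_endo_def)

lemma rho_adj: "a \<in> M \<Longrightarrow> \<rho> (adj a) = adj (\<rho> a)"
  using star_endo by (simp add: star_endo_def)

section \<open>The identity representation and \<rho> on finite direct sums\<close>

definition act :: "bool \<Rightarrow> 'a op \<Rightarrow> 'a op" where
  "act d a = (if d then \<rho> a else a)"

lemma act_M: "a \<in> M \<Longrightarrow> act d a \<in> M"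
  by (simp add: act_def rho_M)

lemma act_oplus: "a \<in> M \<Longrightarrow> b \<in> M \<Longrightarrow> act d (oplus a b) x = act d a x + act d b x"
  by (simp add: act_def rho_oplus) (simp add: oplus_def)

lemma act_cscale: "a \<in> M \<Longrightarrow> act d (cscale J c a) x = Re c *\<^sub>R act d a x + Im c *\<^sub>R J (act d a x)"
  by (simp add: act_def rho_cscale) (simp add: cscale_def)

lemma act_comp: "a \<in> M \<Longrightarrow> b \<in> M \<Longrightarrow> act d (a \<circ> b) x = act d a (act d b x)"
  by (simp add: act_def rho_comp)

lemma act_adj: "a \<in> M \<Longrightarrow> act d (adj a) = adj (act d a)"
  by (simp add: act_def rho_adj)

lemma act_id: "act d id = id"
  by (simp add: act_def unital)

lemma inner_act: "a \<in> M \<Longrightarrow> inner (act d a x) y = inner x (act d (adj a) y)"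
  by (simp add: act_adj inner_adj[OF M_bounded_linear[OF act_M]])

text \<open>\<open>D i\<close> tells whether coordinate i carries \<rho> or the identity
  representation. For N = M this is the cyclic subspace generated by v in the direct sum; for the
  self-adjoint part of M it is only a real subspace.\<close>

definition orbit :: "('i \<Rightarrow> bool) \<Rightarrow> ('i \<Rightarrow> 'a) \<Rightarrow> 'a op set \<Rightarrow> ('i \<Rightarrow> 'a) set" where
  "orbit D v N = (\<lambda>a i. act (D i) a (v i)) ` N"

lemma fibre_subspace_orbit:
  assumes N: "N \<subseteq> M" "id \<in> N" "\<And>a b. a \<in> N \<Longrightarrow> b \<in> N \<Longrightarrow> oplus a b \<in> N"
    "\<And>r a. a \<in> N \<Longrightarrow> cscale J (complex_of_real r) a \<in> N"
  shows "fibre_subspace (orbit D v N)"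
proof -
  have scale: "(\<lambda>i. r *\<^sub>R act (D i) a (v i)) \<in> orbit D v N" if "a \<in> N" for r a
  proof -
    have "(\<lambda>i. r *\<^sub>R act (D i) a (v i)) = (\<lambda>i. act (D i) (cscale J (complex_of_real r) a) (v i))"
      using that N(1) by (intro ext) (subst act_cscale, auto)
    then show ?thesis unfolding orbit_def using N(4)[OF that] by blast
  qed
  have add: "(\<lambda>i. act (D i) a (v i) + act (D i) b (v i)) \<in> orbit D v N" if "a \<in> N" "b \<in> N" for a b
  proof -
    have "(\<lambda>i. act (D i) a (v i) + act (D i) b (v i)) = (\<lambda>i. act (D i) (oplus a b) (v i))"
      using that N(1) by (intro ext) (subst act_oplus, auto)
    then show ?thesis unfolding orbit_def using N(3)[OF that] by blast
  qed
  show ?thesis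
    unfolding fibre_subspace_def
    using scale[OF N(2), of 0] scale add by (auto simp: orbit_def)
qed

lemma seq_limits_orbit_closed:
  assumes L: "closed L" "\<And>a x. a \<in> M \<Longrightarrow> x \<in> L \<Longrightarrow> \<rho> a x \<in> L"
    and w: "w \<in> seq_limits I (orbit D v N)" and N: "N \<subseteq> M" and i: "i \<in> I" "D i" "v i \<in> L"
  shows "w i \<in> L"
proof -
  obtain s where s: "\<And>k. s k \<in> orbit D v N" "(\<lambda>k. s k i) \<longlonglongrightarrow> w i"
    using w i unfolding seq_limits_def by blast
  have "s k i \<in> L" for k
  proof -
    obtain a where "a \<in> N" "s k = (\<lambda>i. act (D i) a (v i))" using s(1)[of k] by (auto simp: orbit_def)
    then show ?thesis using L(2) N i by (auto simp: act_def)
  qed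
  then show ?thesis using closed_sequentially[OF L(1) _ s(2)] by blast
qed

text \<open>\<open>P g j\<close> is the (j,i) matrix entry, applied to g, of the projection onto the
  closed orbit. The orbit is invariant under the self-adjoint algebra M, so this projection commutes
  with the diagonal action; its entry from an identity coordinate to a \<rho> coordinate is
  therefore an intertwiner.\<close>

lemma orbit_projection_block:
  fixes v :: "'i \<Rightarrow> 'a"
  assumes I: "finite I" and ij: "i \<in> I" "j \<in> I" "\<not> D i" "D j"
    and P: "\<And>g. is_proj I (orbit D v M) (\<lambda>k. if k = i then g else 0) (P g)"
  shows "(\<lambda>g. P g j) \<in> BG J" "\<And>a. a \<in> M \<Longrightarrow> \<rho> a \<circ> (\<lambda>g. P g j) = (\<lambda>g. P g j) \<circ> a"
proof -
  let ?S = "orbit D v M" and ?e = "\<lambda>g k. if k = i then g else (0::'a)"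
  have S: "fibre_subspace ?S"
    by (rule fibre_subspace_orbit) (auto simp: id_in_commutant oplus_M cscale_M)
  have uniq: "P g j = w j" if "is_proj I ?S (?e g) w" for g w
    using is_proj_unique[OF I P that] ij by blast
  have add: "P (g + h) j = P g j + P h j" for g h
  proof -
    have "(\<lambda>k. ?e g k + ?e h k) = ?e (g + h)" by auto
    then show ?thesis using uniq[of "g + h"] is_proj_add[OF S P P, of g h] by simp
  qed
  have map: "P (A i g) j = A j (P g j)"
    if "\<And>k. bounded_linear (A k)" "\<And>k x y. inner (A k x) y = inner x (A' k y)"
      "\<And>z. z \<in> ?S \<Longrightarrow> (\<lambda>k. A k (z k)) \<in> ?S" "\<And>z. z \<in> ?S \<Longrightarrow> (\<lambda>k. A' k (z k)) \<in> ?S" for A A' g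
  proof -
    have "is_proj I ?S (\<lambda>k. A k (?e g k)) (\<lambda>k. A k (P g k))"
      by (rule is_proj_map[where A' = A', OF P that])
    moreover have "(\<lambda>k. A k (?e g k)) = ?e (A i g)"
      using that(1) by (auto simp: bounded_linear.linear linear_0)
    ultimately show ?thesis using uniq[of "A i g"] by simp
  qed
  have scale: "P (r *\<^sub>R g) j = r *\<^sub>R P g j" for r g
    by (rule map[of "\<lambda>k x. r *\<^sub>R x" "\<lambda>k x. r *\<^sub>R x"])
       (use S in \<open>auto simp: bounded_linear_scaleR_right fibre_subspace_def\<close>)
  have JS: "(\<lambda>k. J (z k)) \<in> ?S" if z: "z \<in> ?S" for z
  proof -
    obtain a where a: "a \<in> M" "z = (\<lambda>i. act (D i) a (v i))" using z by (auto simp: orbit_def)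
    then have "(\<lambda>k. J (z k)) = (\<lambda>i. act (D i) (cscale J \<i> a) (v i))" by (auto simp: act_cscale)
    then show ?thesis using cscale_M a unfolding orbit_def by blast
  qed
  \<comment> \<open>J is skew for the real inner product, so -J plays the part of the
    adjoint.\<close>
  have J_P: "P (J g) j = J (P g j)" for g
  proof (rule map[of "\<lambda>k. J" "\<lambda>k x. - J x"])
    show "(\<lambda>k. - J (z k)) \<in> ?S" if "z \<in> ?S" for z
    proof -
      have "(\<lambda>k. (-1) *\<^sub>R J (z k)) \<in> ?S" using JS[OF that] S unfolding fibre_subspace_def by fast
      then show ?thesis by simp
    qed
  qed (use J JS in \<open>auto simp: cstruct_bounded_linear cstruct_inner\<close>)
  have act_S: "(\<lambda>k. act (D k) a (z k)) \<in> ?S" if z: "z \<in> ?S" and a: "a \<in> M" for z a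
  proof -
    obtain b where b: "b \<in> M" "z = (\<lambda>i. act (D i) b (v i))" using z by (auto simp: orbit_def)
    then have "(\<lambda>k. act (D k) a (z k)) = (\<lambda>i. act (D i) (a \<circ> b) (v i))" using a by (simp add: act_comp)
    then show ?thesis using comp_in_commutant[OF a b(1)] unfolding orbit_def by blast
  qed
  have act_P: "P (a g) j = \<rho> a (P g j)" if "a \<in> M" for a g
    using map[of "\<lambda>k. act (D k) a" "\<lambda>k. act (D k) (adj a)" g] that ij
    by (simp add: act_S inner_act adj_M M_bounded_linear[OF act_M]) (simp add: act_def)
  have "norm (P g j) \<le> norm g * 1" for g
  proof -
    have "(norm (P g j))\<^sup>2 \<le> (\<Sum>k\<in>I. (norm (?e g k))\<^sup>2)"
      by (rule is_proj_norm[OF I P]) (use ij in auto)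
    also have "\<dots> = (\<Sum>k\<in>I. if k = i then (norm g)\<^sup>2 else 0)"
      by (intro sum.cong) auto
    also have "\<dots> = (norm g)\<^sup>2" using ij I by simp
    finally show ?thesis using power2_le_imp_le[OF _ norm_ge_zero] by simp
  qed
  then show "(\<lambda>g. P g j) \<in> BG J"
    using add scale J_P unfolding BG_iff by (auto intro!: bounded_linear_intro[where K = 1])
  show "\<rho> a \<circ> (\<lambda>g. P g j) = (\<lambda>g. P g j) \<circ> a" if "a \<in> M" for a
    using act_P[OF that] by auto
qed

text \<open>Operators into L are written as operators on G with range in L, so that L need not
  become a Hilbert space of its own. Intertwiners in the opposite direction are the adjoints of
  these.\<close>

definition disjoint_on :: "'a set \<Rightarrow> bool" where
  "disjoint_on L \<longleftrightarrow> closed L \<and> subspace L \<and> (\<forall>a\<in>M. \<forall>x\<in>L. \<rho> a x \<in> L)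
     \<and> (\<forall>T\<in>BG J. (\<forall>a\<in>M. \<rho> a \<circ> T = T \<circ> a) \<and> range T \<subseteq> L \<longrightarrow> (\<forall>g. T g = 0))"

text \<open>This is the bicommutant argument: by disjointness the projection onto the closed orbit
  has no entries between the two kinds of coordinates. The closed orbit contains v, hence also its
  part in the \<rho> coordinates.\<close>

lemma disjoint_density:
  fixes v :: "'i \<Rightarrow> 'a"
  assumes L: "disjoint_on L" and I: "finite I" and v: "\<And>i. i \<in> I \<Longrightarrow> D i \<Longrightarrow> v i \<in> L"
  shows "(\<lambda>i. if D i then v i else 0) \<in> seq_limits I (orbit D v M)"
proof -
  let ?S = "orbit D v M" and ?e = "\<lambda>i g k. if k = i then g else (0::'a)"
    and ?v = "\<lambda>i. if D i then v i else 0"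
  have S: "fibre_subspace ?S"
    by (rule fibre_subspace_orbit) (auto simp: id_in_commutant oplus_M cscale_M)
  obtain w where w: "is_proj I ?S ?v w" using is_proj_exists[OF I S] by blast
  have w_lim: "w \<in> seq_limits I ?S" using w by (simp add: is_proj_def)
  have w0: "w i = 0" if i: "i \<in> I" "\<not> D i" for i
  proof -
    have "\<forall>g. \<exists>w. is_proj I ?S (?e i g) w" using is_proj_exists[OF I S] by blast
    then have "\<exists>P. \<forall>g. is_proj I ?S (?e i g) (P g)" by (rule choice)
    then obtain P where P: "\<And>g. is_proj I ?S (?e i g) (P g)" by blast
    have P0: "P g j = 0" if j: "j \<in> I" "D j" for g j
    proof -
      note block = orbit_projection_block[where P = P, OF I i(1) j(1) i(2) j(2) P]
      have "P g j \<in> L" for g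
        by (rule seq_limits_orbit_closed[of L "P g" I D v M])
           (use L P v j in \<open>auto simp: disjoint_on_def is_proj_def\<close>)
      then have "range (\<lambda>g. P g j) \<subseteq> L" by blast
      with block L show ?thesis unfolding disjoint_on_def by blast
    qed
    have "inner (w i) g = 0" for g
    proof -
      have P_lim: "P g \<in> seq_limits I ?S" using P by (simp add: is_proj_def)
      \<comment> \<open>Symmetry of the projection moves it from \<open>?v\<close> to the vector
        with entry g at i. The result \<open>P g\<close> vanishes on the \<rho> coordinates, and
        \<open>?v\<close> vanishes on all others.\<close>
      have "inner (w i) g = (\<Sum>k\<in>I. if k = i then inner (w k) g else 0)"
        using i I by simp
      also have "\<dots> = (\<Sum>k\<in>I. inner (?e i g k - P g k) (w k)) - (\<Sum>k\<in>I. inner (?v k - w k) (P g k))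
          + (\<Sum>k\<in>I. inner (?v k) (P g k))"
        unfolding sum.distrib[symmetric] sum_subtractf[symmetric]
        by (intro sum.cong refl) (simp add: inner_simps inner_commute)
      also have "\<dots> = (\<Sum>k\<in>I. inner (?v k) (P g k))"
        by (simp add: is_proj_orthogonal[OF P w_lim] is_proj_orthogonal[OF w P_lim])
      also have "\<dots> = 0" by (intro sum.neutral) (auto simp: P0)
      finally show ?thesis .
    qed
    then show ?thesis by (metis inner_eq_zero_iff)
  qed
  have v_lim: "v \<in> seq_limits I ?S"
  proof -
    have "v = (\<lambda>i. act (D i) id (v i))" by (simp add: act_id)
    then have "v \<in> ?S" unfolding orbit_def using id_in_commutant by blast
    then show ?thesis unfolding seq_limits_def by (auto intro!: exI[of _ "\<lambda>k. v"])
  qed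
  \<comment> \<open>Outside D the residual is 0, so the second \<open>?v\<close> may be replaced by
    v, which lies in the orbit and is thus orthogonal to the residual.\<close>
  have "(\<Sum>i\<in>I. inner (?v i - w i) (?v i - w i))
      = (\<Sum>i\<in>I. inner (?v i - w i) (v i)) - (\<Sum>i\<in>I. inner (?v i - w i) (w i))"
    unfolding sum_subtractf[symmetric] by (intro sum.cong refl) (auto simp: w0 inner_simps)
  also have "\<dots> = 0"
    by (simp add: is_proj_orthogonal[OF w v_lim] is_proj_orthogonal[OF w w_lim])
  finally have "?v i - w i = 0" if "i \<in> I" for i
    using sum_inner_self_eq_0[OF I, of "\<lambda>i. ?v i - w i"] that by blast
  then have "w i = ?v i" if "i \<in> I" for i using that by (metis right_minus_eq)
  then show ?thesis using w_lim unfolding seq_limits_def by auto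
qed

text \<open>Approximants a from the previous density cannot simply be replaced by their real parts,
  since nothing is known about the adjoint of a on v. Instead, the residual r of the real projection
  is shown to vanish: it is orthogonal to (a + adj a) v, and the term with adj a equals the inner
  product of a r with v.\<close>

lemma disjoint_density_selfadjoint:
  fixes v :: "'i \<Rightarrow> 'a"
  assumes L: "disjoint_on L" and I: "finite I" and v: "\<And>i. i \<in> I \<Longrightarrow> D i \<Longrightarrow> v i \<in> L"
  shows "(\<lambda>i. if D i then v i else 0) \<in> seq_limits I (orbit D v {a \<in> M. adj a = a})"
proof -
  let ?N = "{a \<in> M. adj a = a}"
  let ?S = "orbit D v ?N" and ?v = "\<lambda>i. if D i then v i else 0"
  have sa_scale: "adj (cscale J (complex_of_real r) a) = cscale J (complex_of_real r) a"
    if "a \<in> ?N" for r a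
    using that M_bounded_linear by (intro adj_eqI) (auto simp: cscale_def inner_adj)
  have "fibre_subspace ?S"
    by (rule fibre_subspace_orbit)
       (auto simp: id_in_commutant oplus_M cscale_M adj_id adj_oplus M_bounded_linear sa_scale)
  then obtain w where w: "is_proj I ?S ?v w" using is_proj_exists[OF I] by blast
  have w_lim: "w \<in> seq_limits I ?S" using w by (simp add: is_proj_def)
  define r where "r i = ?v i - w i" for i
  have r_L: "r i \<in> L" if "i \<in> I" "D i" for i
  proof -
    have "w i \<in> L"
      by (rule seq_limits_orbit_closed[of L w I D v ?N])
         (use L w_lim v that in \<open>auto simp: disjoint_on_def\<close>)
    with L v[OF that] that show ?thesis by (auto simp: r_def disjoint_on_def subspace_diff)
  qed
  \<comment> \<open>Doubling the index set makes one sequence of elements act well on v and on r at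
    the same time.\<close>
  define v2 where "v2 = (\<lambda>(i, b). if b then r i else v i)"
  have v2: "v2 (i, True) = r i" "v2 (i, False) = v i" for i by (simp_all add: v2_def)
  have "(\<lambda>k. if (D \<circ> fst) k then v2 k else 0) \<in> seq_limits (I \<times> UNIV) (orbit (D \<circ> fst) v2 M)"
    by (rule disjoint_density[OF L]) (use I r_L v in \<open>auto simp: v2_def\<close>)
  then obtain s where s: "\<And>k::nat. s k \<in> orbit (D \<circ> fst) v2 M"
      "\<And>i b. i \<in> I \<Longrightarrow> (\<lambda>k. s k (i, b)) \<longlonglongrightarrow> (if D i then v2 (i, b) else 0)"
    unfolding seq_limits_def by fastforce
  have "\<forall>k. \<exists>a\<in>M. s k = (\<lambda>i. act ((D \<circ> fst) i) a (v2 i))"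
    using s(1) unfolding orbit_def by auto
  then obtain a where a: "\<And>k. a k \<in> M" "\<And>k. s k = (\<lambda>i. act ((D \<circ> fst) i) (a k) (v2 i))" by metis
  have av: "(\<lambda>k. act (D i) (a k) (v i)) \<longlonglongrightarrow> ?v i" if "i \<in> I" for i
    using s(2)[OF that, of False] by (simp add: a(2) v2 cong: if_cong)
  have ar: "(\<lambda>k. act (D i) (a k) (r i)) \<longlonglongrightarrow> (if D i then r i else 0)" if "i \<in> I" for i
    using s(2)[OF that, of True] by (simp add: a(2) v2 cong: if_cong)
  have "(\<Sum>i\<in>I. inner (r i) (act (D i) (a k) (v i)) + inner (act (D i) (a k) (r i)) (v i)) = 0" for k
  proof -
    let ?b = "oplus (a k) (adj (a k))"
    have "?b \<in> ?N"
    proof -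
      have "adj ?b = oplus (adj (a k)) (a k)"
        using a(1) by (simp add: adj_oplus M_bounded_linear adj_M adj_adj)
      also have "\<dots> = ?b" by (auto simp: oplus_def)
      finally show ?thesis using a(1) oplus_M adj_M by blast
    qed
    then have "(\<lambda>i. act (D i) ?b (v i)) \<in> ?S" unfolding orbit_def by blast
    then have "(\<Sum>i\<in>I. inner (r i) (act (D i) ?b (v i))) = 0"
      using w unfolding is_proj_def r_def by fast
    moreover have "(\<Sum>i\<in>I. inner (r i) (act (D i) ?b (v i)))
      = (\<Sum>i\<in>I. inner (r i) (act (D i) (a k) (v i)) + inner (act (D i) (a k) (r i)) (v i))"
      using a(1) by (intro sum.cong refl) (simp add: act_oplus adj_M inner_act inner_add_right)
    ultimately show ?thesis by simp
  qed
  moreover have "(\<lambda>k. \<Sum>i\<in>I. inner (r i) (act (D i) (a k) (v i)) + inner (act (D i) (a k) (r i)) (v i))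
     \<longlonglongrightarrow> (\<Sum>i\<in>I. inner (r i) (?v i) + inner (if D i then r i else 0) (v i))"
    by (intro tendsto_sum tendsto_add tendsto_inner tendsto_const av ar)
  ultimately have "(\<Sum>i\<in>I. inner (r i) (?v i) + inner (if D i then r i else 0) (v i)) = 0"
    by (simp add: LIMSEQ_const_iff)
  \<comment> \<open>The two terms agree on the \<rho> coordinates, and both are 0 elsewhere.\<close>
  moreover have "(\<Sum>i\<in>I. inner (r i) (?v i) + inner (if D i then r i else 0) (v i))
      = 2 * (\<Sum>i\<in>I. inner (r i) (?v i))"
    unfolding sum_distrib_left by (intro sum.cong) auto
  ultimately have "(\<Sum>i\<in>I. inner (r i) (?v i)) = 0" by simp
  moreover have "(\<Sum>i\<in>I. inner (r i) (w i)) = 0"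
    using is_proj_orthogonal[OF w w_lim] by (simp add: r_def)
  moreover have "(\<Sum>i\<in>I. inner (r i) (r i)) = (\<Sum>i\<in>I. inner (r i) (?v i)) - (\<Sum>i\<in>I. inner (r i) (w i))"
    unfolding sum_subtractf[symmetric] inner_diff_right[symmetric] r_def ..
  ultimately have "(\<Sum>i\<in>I. inner (r i) (r i)) = 0" by simp
  then have "w i = ?v i" if "i \<in> I" for i
    using sum_inner_self_eq_0[OF I, of r] that by (simp add: r_def)
  then show ?thesis using w_lim unfolding seq_limits_def by auto
qed

section \<open>Contractions that separate the two representations, and the contradiction to
  normality\<close>

lemma selfadjoint_M:
  assumes "a \<in> M" "adj a = a"
  shows "inner (a x) y = inner x (a y)" "inner (\<rho> a x) y = inner x (\<rho> a y)"
  using assms inner_act[of a False] inner_act[of a True] by (simp_all add: act_def)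

lemma disjoint_contraction:
  assumes L: "disjoint_on L" and X: "finite X" and \<xi>: "\<xi> \<in> L" "\<xi> \<noteq> 0" and "0 < \<epsilon>"
  shows "\<exists>c\<in>M. onorm c \<le> 1 \<and> adj c = c \<and> (\<forall>x. 0 \<le> inner x (c x))
     \<and> (\<forall>x\<in>X. inner x (c x) < \<epsilon>) \<and> (norm \<xi>)\<^sup>2 / 4 \<le> inner \<xi> (\<rho> c \<xi>)"
proof -
  \<comment> \<open>\<open>None\<close> carries \<xi> under \<rho>; \<open>Some x\<close> carries x
    under the identity representation.\<close>
  let ?I = "insert None (Some ` X)" and ?D = "\<lambda>i. i = None" and ?v = "case_option \<xi> (\<lambda>x. x)"
  have "(\<lambda>i. if ?D i then ?v i else 0) \<in> seq_limits ?I (orbit ?D ?v {a \<in> M. adj a = a})"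
    by (rule disjoint_density_selfadjoint[OF L]) (use X \<xi> in auto)
  then obtain s where s: "\<And>k::nat. s k \<in> orbit ?D ?v {a \<in> M. adj a = a}"
      "\<And>i. i \<in> ?I \<Longrightarrow> (\<lambda>k. s k i) \<longlonglongrightarrow> (if ?D i then ?v i else 0)"
    unfolding seq_limits_def by blast
  have "\<forall>k. \<exists>a. a \<in> M \<and> adj a = a \<and> s k = (\<lambda>i. act (?D i) a (?v i))"
    using s(1) unfolding orbit_def by auto
  from choice[OF this] obtain b where b: "\<And>k. b k \<in> M" "\<And>k. adj (b k) = b k"
      "\<And>k. s k = (\<lambda>i. act (?D i) (b k) (?v i))" by blast
  have "(\<lambda>k. \<rho> (b k) \<xi>) \<longlonglongrightarrow> \<xi>" using s(2)[of None] by (simp add: b(3) act_def)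
  then have "(\<lambda>k. norm (\<rho> (b k) \<xi> - \<xi>)) \<longlonglongrightarrow> 0" by (simp add: LIM_zero tendsto_norm_zero)
  \<comment> \<open>The tolerance 1/4 is what the final estimate allows: if the claim failed, the
    three terms of \<open>main\<close> would sum to less than 1/4 + 1/2 + 1/4 of the square of the
    norm of \<xi>.\<close>
  then have ev1: "\<forall>\<^sub>F k in sequentially. norm (\<rho> (b k) \<xi> - \<xi>) < norm \<xi> / 4"
    using \<xi> by (intro order_tendstoD) auto
  have "\<forall>\<^sub>F k in sequentially. (norm (b k x))\<^sup>2 < \<epsilon>" if "x \<in> X" for x
  proof -
    have "(\<lambda>k. b k x) \<longlonglongrightarrow> 0" using s(2)[of "Some x"] that by (simp add: b(3) act_def)
    then have "(\<lambda>k. (norm (b k x))\<^sup>2) \<longlonglongrightarrow> 0" by (auto intro!: tendsto_eq_intros)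
    then show ?thesis using \<open>0 < \<epsilon>\<close> by (rule order_tendstoD)
  qed
  then have "\<forall>\<^sub>F k in sequentially. \<forall>x\<in>X. (norm (b k x))\<^sup>2 < \<epsilon>"
    using X by (simp add: eventually_ball_finite)
  with ev1 have "\<forall>\<^sub>F k in sequentially. norm (\<rho> (b k) \<xi> - \<xi>) < norm \<xi> / 4 \<and> (\<forall>x\<in>X. (norm (b k x))\<^sup>2 < \<epsilon>)"
    by (rule eventually_conj)
  then obtain k where k: "norm (\<rho> (b k) \<xi> - \<xi>) < norm \<xi> / 4" "\<forall>x\<in>X. (norm (b k x))\<^sup>2 < \<epsilon>"
    using eventually_happens by fastforce
  define a where "a = b k"
  have a: "a \<in> M" "adj a = a" using b by (auto simp: a_def)
  obtain R where R: "R \<in> M" "\<And>y. R y + a (a (R y)) = y" "adj R = R"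
    using resolvent_exists[OF J B a] by blast
  \<comment> \<open>c is the image of a under the function t^2 / (1 + t^2), which maps R into [0,1],
    is dominated by t^2 and takes the value 1/2 at 1.\<close>
  define c where "c = oplus id (cscale J (-1) R)"
  have c_app: "c y = y - R y" for y by (simp add: c_def oplus_def cscale_def)
  have c_M: "c \<in> M" unfolding c_def using R(1) by (intro oplus_M cscale_M id_in_commutant)
  have c_app2: "c y = a (a (R y))" for y using R(2)[of y] by (metis c_app add_diff_cancel_left')
  interpret a: bounded_linear a using a(1) by (rule M_bounded_linear)
  note sym = selfadjoint_M(1)[OF a]
  have c_adj: "adj c = c"
    by (rule adj_eqI) (simp add: c_app inner_simps selfadjoint_M(1)[OF R(1,3)])
  have quad: "inner y (c y) = inner (a (R y)) (a (R y)) + inner (a (a (R y))) (a (a (R y)))" for y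
  proof -
    have "inner y (c y) = inner (R y + a (a (R y))) (a (a (R y)))" by (simp add: R(2) c_app2)
    also have "\<dots> = inner (R y) (a (a (R y))) + inner (a (a (R y))) (a (a (R y)))"
      by (rule inner_add_left)
    finally show ?thesis by (simp add: sym[of "R y"])
  qed
  \<comment> \<open>This is t^2 / (1 + t^2) \<le> t^2, with a y expanded through y = R y + a (a (R
    y)); it makes c small on X.\<close>
  have c_le: "inner y (c y) \<le> (norm (a y))\<^sup>2" for y
  proof -
    let ?x = "R y"
    have "a y = a ?x + a (a (a ?x))" using R(2)[of y] by (metis a.add)
    then have "(norm (a y))\<^sup>2 = inner (a ?x) (a ?x) + 2 * inner (a ?x) (a (a (a ?x)))
        + inner (a (a (a ?x))) (a (a (a ?x)))"
      by (simp add: power2_norm_eq_inner inner_simps inner_commute)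
    moreover have "inner (a ?x) (a (a (a ?x))) = inner (a (a ?x)) (a (a ?x))"
      by (simp add: sym[of "a ?x"])
    moreover have "0 \<le> inner (a (a ?x)) (a (a ?x))" "0 \<le> inner (a (a (a ?x))) (a (a (a ?x)))"
      by (rule inner_ge_zero)+
    ultimately show ?thesis unfolding quad by linarith
  qed
  have c_norm: "norm (c y) \<le> 1 * norm y" for y
  proof -
    let ?x = "R y"
    have "(norm y)\<^sup>2 = inner (?x + a (a ?x)) (?x + a (a ?x))" by (simp add: R(2) power2_norm_eq_inner)
    also have "\<dots> = inner ?x ?x + 2 * inner ?x (a (a ?x)) + inner (a (a ?x)) (a (a ?x))"
      by (simp add: inner_add_left inner_add_right inner_commute)
    also have "inner ?x (a (a ?x)) = inner (a ?x) (a ?x)" by (simp add: sym[of ?x])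
    finally have "(norm (c y))\<^sup>2 \<le> (norm y)\<^sup>2"
      using inner_ge_zero[of "a ?x"] inner_ge_zero[of ?x]
      unfolding c_app2 power2_norm_eq_inner by linarith
    then show ?thesis using power2_le_imp_le[OF _ norm_ge_zero] by simp
  qed
  have "(norm \<xi>)\<^sup>2 / 4 \<le> inner \<xi> (\<rho> c \<xi>)"
  proof -
    let ?N = "norm \<xi>" and ?b = "\<rho> a"
    define z where "z = \<rho> R \<xi>"
    interpret b: bounded_linear ?b using rho_M[OF a(1)] by (rule M_bounded_linear)
    note symb = selfadjoint_M(2)[OF a]
    have rc: "\<rho> c \<xi> = \<xi> - z"
      unfolding c_def z_def using R(1)
      by (simp add: rho_oplus rho_cscale cscale_M id_in_commutant unital)
    \<comment> \<open>The equation defining R is purely algebraic, so the unital homomorphism \<rho>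
      carries it over: \<open>\<rho> R\<close> inverts 1 + b^2 for b =
      \<open>\<rho> a\<close>.\<close>
    have "oplus R (a \<circ> (a \<circ> R)) = id" using R(2) by (auto simp: oplus_def)
    then have "\<rho> (oplus R (a \<circ> (a \<circ> R))) \<xi> = \<xi>" by (simp add: unital)
    then have z: "z + ?b (?b z) = \<xi>"
      unfolding z_def using a(1) R(1) by (simp add: rho_oplus rho_comp comp_in_commutant)
    define p where "p = inner \<xi> (\<rho> c \<xi>)"
    have zz: "inner \<xi> z = ?N\<^sup>2 - p" unfolding p_def rc by (simp add: inner_simps power2_norm_eq_inner)
    have p: "p = (norm (?b z))\<^sup>2 + (norm (?b (?b z)))\<^sup>2"
    proof -
      have "\<xi> - z = ?b (?b z)" using z by (metis add_diff_cancel_left')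
      then have "p = inner (z + ?b (?b z)) (?b (?b z))" unfolding p_def rc by (simp add: z)
      also have "\<dots> = inner z (?b (?b z)) + inner (?b (?b z)) (?b (?b z))" by (rule inner_add_left)
      finally show ?thesis by (simp add: symb[of z] power2_norm_eq_inner)
    qed
    have nz: "norm z \<le> ?N"
    proof -
      have "?N\<^sup>2 = inner (z + ?b (?b z)) (z + ?b (?b z))" by (simp add: z power2_norm_eq_inner)
      also have "\<dots> = inner z z + 2 * inner z (?b (?b z)) + inner (?b (?b z)) (?b (?b z))"
        by (simp add: inner_add_left inner_add_right inner_commute)
      also have "inner z (?b (?b z)) = inner (?b z) (?b z)" by (simp add: symb[of z])
      finally have "(norm z)\<^sup>2 \<le> ?N\<^sup>2"
        using inner_ge_zero[of "?b z"] inner_ge_zero[of "?b (?b z)"]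
        unfolding power2_norm_eq_inner by linarith
      then show ?thesis using power2_le_imp_le[OF _ norm_ge_zero] by simp
    qed
    \<comment> \<open>Insert b \<xi>, which is close to \<xi>, and move b to z by symmetry; the norm
      of b z is controlled by p.\<close>
    have "inner \<xi> z = inner \<xi> (?b z) - inner (?b \<xi> - \<xi>) z" by (simp add: inner_simps symb)
    also have "\<dots> \<le> ?N * norm (?b z) + norm (?b \<xi> - \<xi>) * norm z"
      using norm_cauchy_schwarz[of \<xi> "?b z"] norm_cauchy_schwarz[of "- (?b \<xi> - \<xi>)" z]
      by (simp add: norm_minus_commute inner_simps)
    also have "\<dots> \<le> ?N * norm (?b z) + ?N / 4 * ?N"
      using k(1) nz by (intro add_left_mono mult_mono) (auto simp: a_def)
    finally have main: "?N\<^sup>2 \<le> p + ?N * norm (?b z) + ?N\<^sup>2 / 4"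
      using zz by (simp add: power2_eq_square)
    have N0: "0 < ?N" using \<xi> by simp
    show ?thesis
    proof (rule ccontr)
      assume "\<not> ?thesis"
      then have p_small: "p < ?N\<^sup>2 / 4" by (simp add: p_def)
      moreover have "(?N / 2)\<^sup>2 = ?N\<^sup>2 / 4" by (simp add: power_divide)
      ultimately have "(norm (?b z))\<^sup>2 < (?N / 2)\<^sup>2"
        using p zero_le_power2[of "norm (?b (?b z))"] by linarith
      then have "norm (?b z) < ?N / 2" by (rule power2_less_imp_less) (use N0 in simp)
      then have "?N * norm (?b z) < ?N * (?N / 2)" using N0 by simp
      then have "?N * norm (?b z) < ?N\<^sup>2 / 2" by (simp add: power2_eq_square)
      with main p_small show False by linarith
    qed
  qed
  moreover have "onorm c \<le> 1" by (rule onorm_bound) (use c_norm in auto)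
  moreover have "0 \<le> inner x (c x)" for x unfolding quad by simp
  moreover have "inner x (c x) < \<epsilon>" if "x \<in> X" for x
    using c_le[of x] k(2) that by (auto simp: a_def intro: le_less_trans)
  ultimately show ?thesis using c_M c_adj by blast
qed

text \<open>Positivity at x + y and x - y bounds twice the mixed term by the sum of the two diagonal
  terms. Smallness of the quadratic form thus yields weak smallness.\<close>

lemma positive_cauchy_schwarz:
  fixes c :: "'a op"
  assumes c: "bounded_linear c" "adj c = c" "\<And>x. 0 \<le> inner x (c x)"
    and e: "inner x (c x) < e" "inner y (c y) < e"
  shows "\<bar>inner x (c y)\<bar> < e"
proof -
  interpret c: bounded_linear c by fact
  have sym: "inner y (c x) = inner x (c y)" using inner_adj[OF c(1), of y x] c(2)
    by (metis inner_commute)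
  have "0 \<le> inner (x + y) (c (x + y))" "0 \<le> inner (x - y) (c (x - y))" by (rule c(3))+
  then show ?thesis using e by (simp add: c.add c.diff inner_simps sym)
qed

text \<open>The separating contractions are arranged in a net indexed by finite sets of demands: a
  pair (x, n) asks that the form of c at x be below 1 / (n + 1). The net tends weakly to 0, yet its
  image under \<rho> stays away from 0 at \<xi>.\<close>

lemma disjoint_on_trivial:
  assumes L: "disjoint_on L"
  shows "L = {0}"
proof (rule ccontr)
  assume "L \<noteq> {0}"
  moreover have "0 \<in> L" using L by (auto simp: disjoint_on_def subspace_0)
  ultimately obtain \<xi> where \<xi>: "\<xi> \<in> L" "\<xi> \<noteq> 0" by blast
  let ?P = "\<lambda>Y c. c \<in> M \<and> onorm c \<le> 1 \<and> adj c = c \<and> (\<forall>x. 0 \<le> inner x (c x))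
     \<and> (\<forall>(x, n)\<in>Y. inner x (c x) < 1 / real (Suc n)) \<and> (norm \<xi>)\<^sup>2 / 4 \<le> inner \<xi> (\<rho> c \<xi>)"
  have "\<exists>c. finite Y \<longrightarrow> ?P Y c" for Y :: "('a \<times> nat) set"
  proof (cases "finite Y")
    case True
    \<comment> \<open>The extra 1 keeps the minimum defined for empty Y.\<close>
    define \<epsilon> where "\<epsilon> = Min (insert 1 ((\<lambda>(x, n). 1 / real (Suc n)) ` Y))"
    have "0 < \<epsilon>" unfolding \<epsilon>_def using True by (subst Min_gr_iff) auto
    moreover have "\<epsilon> \<le> 1 / real (Suc n)" if "(x, n) \<in> Y" for x n
      unfolding \<epsilon>_def using True that by (intro Min_le) force+
    moreover obtain c where c: "c\<in>M" "onorm c \<le> 1" "adj c = c" "\<forall>x. 0 \<le> inner x (c x)"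
       "\<forall>x\<in>fst ` Y. inner x (c x) < \<epsilon>" "(norm \<xi>)\<^sup>2 / 4 \<le> inner \<xi> (\<rho> c \<xi>)"
      using disjoint_contraction[OF L, of "fst ` Y" \<xi> \<epsilon>] True \<xi> \<open>0 < \<epsilon>\<close> by auto
    ultimately have "?P Y c" by (force intro: less_le_trans)
    then show ?thesis by blast
  qed simp
  then have "\<forall>Y. \<exists>c. finite Y \<longrightarrow> ?P Y c" by blast
  from choice[OF this] obtain c where c: "\<And>Y. finite Y \<Longrightarrow> ?P Y (c Y)" by blast
  define F where "F = filtermap c (finite_subsets_at_top UNIV)"
  \<comment> \<open>Zero is written as a scalar multiple of 1, so that \<rho> sends it to zero by
    homogeneity.\<close>
  define Z where "Z = cscale J 0 (id :: 'a op)"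
  have Z: "Z \<in> M" unfolding Z_def by (intro cscale_M id_in_commutant)
  have "\<forall>\<^sub>F S in F. S \<in> M \<and> onorm S \<le> 1"
    unfolding F_def eventually_filtermap
    using c by (auto simp: eventually_finite_subsets_at_top intro!: exI[of _ "{}"])
  moreover have "wot_tendsto (\<lambda>S. S) Z F"
    unfolding wot_tendsto_def
  proof (intro allI tendstoI)
    fix x y :: 'a and e :: real assume "0 < e"
    then obtain n where n: "1 / real (Suc n) < e"
      using reals_Archimedean[of e] by (auto simp: inverse_eq_divide)
    have "dist (inner x (c Y y)) (inner x (Z y)) < e" if "finite Y" "{(x, n), (y, n)} \<subseteq> Y" for Y
    proof -
      have "\<bar>inner x (c Y y)\<bar> < 1 / real (Suc n)"
        by (rule positive_cauchy_schwarz) (use c[OF that(1)] that(2) M_bounded_linear in auto)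
      then show ?thesis using n by (simp add: Z_def cscale_def)
    qed
    then show "\<forall>\<^sub>F S in F. dist (inner x (S y)) (inner x (Z y)) < e"
      unfolding F_def eventually_filtermap eventually_finite_subsets_at_top
      by (intro exI[of _ "{(x, n), (y, n)}"]) auto
  qed
  ultimately have "wot_tendsto \<rho> (\<rho> Z) F"
    using normal Z unfolding normal_map_def by blast
  then have "((\<lambda>S. inner \<xi> (\<rho> S \<xi>)) \<longlongrightarrow> inner \<xi> (\<rho> Z \<xi>)) F"
    unfolding wot_tendsto_def by blast
  moreover have "\<rho> Z \<xi> = 0" unfolding Z_def by (simp add: rho_cscale id_in_commutant)
  ultimately have "((\<lambda>S. inner \<xi> (\<rho> S \<xi>)) \<longlongrightarrow> 0) F" by simp
  moreover have "\<forall>\<^sub>F S in F. (norm \<xi>)\<^sup>2 / 4 \<le> inner \<xi> (\<rho> S \<xi>)"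
    unfolding F_def eventually_filtermap
    using c by (auto simp: eventually_finite_subsets_at_top intro!: exI[of _ "{}"])
  moreover have "F \<noteq> bot" unfolding F_def by (simp add: filtermap_bot_iff)
  ultimately have "(norm \<xi>)\<^sup>2 / 4 \<le> 0" by (rule tendsto_lowerbound)
  then show False using \<xi> by simp
qed

end

section \<open>Unitaries and automorphisms of B(G)\<close>

definition unitary_op :: "('a::{real_inner,complete_space}) op \<Rightarrow> 'a op \<Rightarrow> bool" where
  "unitary_op J U \<longleftrightarrow> U \<in> BG J \<and> (\<forall>x. adj U (U x) = x) \<and> (\<forall>x. U (adj U x) = x)"

lemma unitary_op_bounded_linear: "unitary_op J U \<Longrightarrow> bounded_linear U"
  by (simp add: unitary_op_def BG_iff)

lemma unitary_op_id: "unitary_op J id"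
  by (simp add: unitary_op_def id_in_BG adj_id)

lemma unitary_op_comp:
  assumes "unitary_op J U" "unitary_op J V"
  shows "unitary_op J (U \<circ> V)"
proof -
  have "adj (U \<circ> V) = adj V \<circ> adj U"
    using assms by (simp add: unitary_op_bounded_linear adj_comp)
  then show ?thesis using assms by (simp add: unitary_op_def comp_in_BG)
qed

lemma unitary_op_adj:
  assumes "cstruct J" "unitary_op J U"
  shows "unitary_op J (adj U)"
  using assms adj_adj[OF unitary_op_bounded_linear[OF assms(2)]] by (simp add: unitary_op_def adj_in_BG)

lemma norm_unitary_op:
  assumes "unitary_op J U"
  shows "norm (U x) = norm x"
proof -
  have "inner (U x) (U x) = inner x x"
    using assms inner_adj[OF unitary_op_bounded_linear[OF assms], of x "U x"] by (simp add: unitary_op_def)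
  then show ?thesis by (simp add: norm_eq_sqrt_inner)
qed

lemma unitary_opI:
  assumes "U \<in> BG J" "\<And>x y. inner (U x) (U y) = inner x y" "surj U"
  shows "unitary_op J U"
proof -
  have "inner x (adj U (U y)) = inner x y" for x y
    using assms inner_adj[of U x "U y"] by (simp add: BG_iff)
  then have "adj U (U y) = y" for y by (metis vector_eq_ldot)
  moreover from this have "U (adj U y) = y" for y using assms(3) by (metis surj_def)
  ultimately show ?thesis using assms(1) by (simp add: unitary_op_def)
qed

lemma inner_cstruct_self: "cstruct J \<Longrightarrow> inner x (J x) = 0"
  using cstruct_inner[of J x x] by (simp add: inner_commute)

lemma norm_cscale:
  assumes J: "cstruct J"
  shows "norm (cscale J c T x) = cmod c * norm (T x)"
proof -
  have "inner (J (T x)) (J (T x)) = inner (T x) (T x)" using J by (simp add: cstruct_def)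
  then have "(norm (cscale J c T x))\<^sup>2 = (cmod c * norm (T x))\<^sup>2"
    using inner_cstruct_self[OF J, of "T x"] unfolding power_mult_distrib cmod_power2
    by (simp add: cscale_def power2_norm_eq_inner inner_simps inner_commute)
       (simp add: power2_eq_square algebra_simps)
  then show ?thesis by (metis power2_eq_imp_eq norm_ge_zero mult_nonneg_nonneg)
qed

lemma cscale_cscale:
  assumes "cstruct J"
  shows "cscale J c (cscale J d T) = cscale J (c * d) T"
  using assms by (auto simp: cscale_def cstruct_def linear_add linear_scale fun_eq_iff algebra_simps)

lemma cscale_comp_left: "cscale J c S \<circ> T = cscale J c (S \<circ> T)"
  by (auto simp: cscale_def)

lemma cscale_comp_right:
  assumes "S \<in> BG J"
  shows "S \<circ> cscale J c T = cscale J c (S \<circ> T)"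
  using assms by (auto simp: cscale_def BG_iff bounded_linear.linear linear_add linear_scale)

lemma cscale_inj:
  assumes J: "cstruct J" and eq: "cscale J c T = cscale J d T" and "T x \<noteq> 0"
  shows "c = d"
proof -
  have "cscale J (c - d) T x = cscale J c T x - cscale J d T x"
    by (simp add: cscale_def algebra_simps)
  then have "cmod (c - d) * norm (T x) = 0"
    using eq norm_cscale[OF J, of "c - d" T x] by simp
  with \<open>T x \<noteq> 0\<close> show ?thesis by simp
qed

text \<open>The operator x<y,.> for the complex inner product antilinear in the first argument.\<close>

definition rank_one :: "('a::{real_inner,complete_space}) op \<Rightarrow> 'a \<Rightarrow> 'a \<Rightarrow> 'a op" where
  "rank_one J x y z = inner y z *\<^sub>R x + inner (J y) z *\<^sub>R J x"

context
  fixes J :: "'a::{real_inner,complete_space} op"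
  assumes J: "cstruct J"
begin

lemma rank_one_in_BG: "rank_one J x y \<in> BG J"
proof -
  have "bounded_linear (\<lambda>z. inner y z *\<^sub>R x + inner (J y) z *\<^sub>R J x)"
    by (intro bounded_linear_add bounded_linear_compose[OF bounded_linear_scaleR_left]
        bounded_linear_inner_right)
  moreover have "inner y (J z) = - inner (J y) z" "inner (J y) (J z) = inner y z" for z
    using J cstruct_inner[OF J, of y z] by (auto simp: cstruct_def)
  ultimately show ?thesis
    using J by (simp add: BG_iff rank_one_def[abs_def] cstruct_def linear_add linear_scale algebra_simps)
qed

lemma rank_one_add: "rank_one J (x + y) e = oplus (rank_one J x e) (rank_one J y e)"
  using J by (auto simp: rank_one_def oplus_def cstruct_def linear_add algebra_simps)

lemma rank_one_cscale:
  "rank_one J (c *\<^sub>R x + d *\<^sub>R J x) e = cscale J (Complex c d) (rank_one J x e)"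
  using J by (auto simp: rank_one_def cscale_def cstruct_def linear_add linear_scale algebra_simps)

lemma comp_rank_one:
  assumes "a \<in> BG J"
  shows "a \<circ> rank_one J x e = rank_one J (a x) e"
  using assms by (auto simp: rank_one_def BG_iff bounded_linear.linear linear_add linear_scale)

lemma adj_rank_one: "adj (rank_one J x y) = rank_one J y x"
  by (rule adj_eqI) (simp add: rank_one_def inner_simps inner_commute)

lemma rank_one_apply_unit:
  assumes "norm e = 1"
  shows "rank_one J x e e = x"
  using assms inner_cstruct_self[OF J, of e]
  by (simp add: rank_one_def inner_commute norm_eq_1)

text \<open>\<open>rank_one J x e\<close> sends e to x. Commutation evaluated at e therefore makes T
  x the multiple of x by the complex inner product of e with T e.\<close>

lemma commute_all_imp_scalar:
  assumes "norm e = 1" "\<And>x. T (rank_one J x e e) = rank_one J x e (T e)"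
  shows "\<exists>c. T = cscale J c id"
proof -
  have "T x = rank_one J x e (T e)" for x using assms(2)[of x] rank_one_apply_unit[OF assms(1)] by simp
  then have "T x = cscale J (Complex (inner e (T e)) (inner (J e) (T e))) id x" for x
    unfolding rank_one_def cscale_def complex.sel id_apply .
  then show ?thesis by blast
qed

text \<open>\<open>adj W \<circ> V\<close> commutes with every bounded operator, hence is a scalar;
  comparing norms at e shows that it is a phase.\<close>

lemma unitary_implementation_unique:
  assumes V: "unitary_op J V" and W: "unitary_op J W" and e: "norm (e::'a) = 1"
    and \<psi>: "\<And>a. a \<in> BG J \<Longrightarrow> \<psi> a \<circ> V = V \<circ> a" "\<And>a. a \<in> BG J \<Longrightarrow> \<psi> a \<circ> W = W \<circ> a"
  shows "\<exists>c. cmod c = 1 \<and> V = cscale J c W"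
proof -
  have "(adj W \<circ> V) (a x) = a ((adj W \<circ> V) x)" if a: "a \<in> BG J" for a x
  proof -
    have "V (a x) = \<psi> a (W (adj W (V x)))"
      using \<psi>(1)[OF a] W by (simp add: fun_eq_iff unitary_op_def)
    also have "\<dots> = W (a (adj W (V x)))" using \<psi>(2)[OF a] by (simp add: fun_eq_iff)
    finally show ?thesis using W by (simp add: unitary_op_def)
  qed
  then obtain c where c: "adj W \<circ> V = cscale J c id"
    using commute_all_imp_scalar[OF e] rank_one_in_BG by metis
  have "V = W \<circ> (adj W \<circ> V)" using W by (auto simp: unitary_op_def)
  also have "\<dots> = cscale J c W" using W unfolding c by (simp add: cscale_comp_right unitary_op_def)
  finally have V_eq: "V = cscale J c W" .
  then have "norm (V e) = cmod c * norm (W e)" using norm_cscale[OF J] by metis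
  then have "cmod c = 1" using e by (simp add: norm_unitary_op[OF V] norm_unitary_op[OF W])
  with V_eq show ?thesis by blast
qed

text \<open>For a rank-one projection p onto the line of e, pick a unit vector f fixed by \<phi> p
  and let U send x to the image of f under \<phi> of the operator taking e to x. Multiplicativity
  gives the intertwining relation; the products of these rank-one operators with adjoints are
  multiples of p, which gives isometry.\<close>

lemma automorphism_inner:
  assumes endo: "star_endo J (BG J) \<phi>" and bij: "bij_betw \<phi> (BG J) (BG J)"
  shows "\<exists>U. unitary_op J U \<and> (\<forall>a\<in>BG J. \<phi> a \<circ> U = U \<circ> a)"
proof (cases "\<exists>x::'a. x \<noteq> 0")
  case False
  then have "S = T" for S T :: "'a op" by (intro ext) metis
  then show ?thesis using unitary_op_id[of J] by (intro exI[of _ id]) auto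
next
  case True
  then obtain e :: 'a where e: "norm e = 1" by (metis norm_sgn)
  let ?r = "\<lambda>x. rank_one J x e"
  have \<phi>_BG: "\<phi> a \<in> BG J" if "a \<in> BG J" for a using endo that by (simp add: star_endo_def)
  have \<phi>_comp: "\<phi> (a \<circ> b) x = \<phi> a (\<phi> b x)" if "a \<in> BG J" "b \<in> BG J" for a b x
    using endo that by (simp add: star_endo_def)
  have \<phi>_cscale: "\<phi> (cscale J c a) x = cscale J c (\<phi> a) x" if "a \<in> BG J" for a c x
    using endo that by (simp add: star_endo_def)
  have \<phi>_oplus: "\<phi> (oplus a b) x = \<phi> a x + \<phi> b x" if "a \<in> BG J" "b \<in> BG J" for a b x
    using endo that by (simp add: star_endo_def oplus_def)
  have \<phi>_adj: "\<phi> (adj a) = adj (\<phi> a)" if "a \<in> BG J" for a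
    using endo that by (simp add: star_endo_def)
  define p where "p = ?r e"
  have p: "p \<in> BG J" by (simp add: p_def rank_one_in_BG)
  have pp: "p \<circ> p = p" using comp_rank_one[OF p] rank_one_apply_unit[OF e] by (simp add: p_def)
  have "\<exists>g. \<phi> p g \<noteq> 0"
  proof (rule ccontr)
    assume "\<not> ?thesis"
    then have "\<phi> p x = \<phi> (cscale J 0 p) x" for x
      using \<phi>_cscale[OF p, of 0 x] by (simp add: cscale_def[of J 0 "\<phi> p"])
    then have "p = cscale J 0 p"
      using inj_onD[OF bij_betw_imp_inj_on[OF bij] _ p cscale_in_BG[OF J p]] by blast
    then have "p e = cscale J 0 p e" by (rule fun_cong)
    then have "p e = 0" by (simp add: cscale_def)
    then show False using rank_one_apply_unit[OF e] e by (simp add: p_def)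
  qed
  then obtain g where g: "\<phi> p g \<noteq> 0" by blast
  define f where "f = sgn (\<phi> p g)"
  have f: "norm f = 1" using g by (simp add: f_def norm_sgn)
  have pf: "\<phi> p f = f"
  proof -
    have "linear (\<phi> p)" using \<phi>_BG[OF p] by (simp add: BG_iff bounded_linear.linear)
    then show ?thesis using \<phi>_comp[OF p p, of g] by (simp add: f_def sgn_div_norm linear_scale pp)
  qed
  define U where "U x = \<phi> (?r x) f" for x
  have U_inner: "inner (U x) (U y) = inner x y" for x y
  proof -
    have "inner (U x) (U y) = inner f (\<phi> (rank_one J e x) (\<phi> (?r y) f))"
      using inner_adj[OF BG_bounded_linear[OF \<phi>_BG[OF rank_one_in_BG]]]
        \<phi>_adj[OF rank_one_in_BG, of x e]
      by (simp add: U_def adj_rank_one)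
    also have "\<dots> = inner f (\<phi> (rank_one J e x \<circ> ?r y) f)"
      by (simp add: \<phi>_comp rank_one_in_BG)
    also have "rank_one J e x \<circ> ?r y = cscale J (Complex (inner x y) (inner (J x) y)) p"
      unfolding p_def rank_one_cscale[symmetric] comp_rank_one[OF rank_one_in_BG] rank_one_def ..
    \<comment> \<open>The imaginary part of the complex inner product multiplies
      \<open>inner f (J f)\<close>, which is 0.\<close>
    also have "inner f (\<phi> \<dots> f) = inner x y * inner f f + inner (J x) y * inner f (J f)"
      unfolding \<phi>_cscale[OF p] by (simp add: cscale_def pf inner_simps)
    also have "\<dots> = inner x y" using f inner_cstruct_self[OF J, of f] by (simp add: norm_eq_1)
    finally show ?thesis .
  qed
  have U_cscale: "U (c *\<^sub>R x + d *\<^sub>R J x) = c *\<^sub>R U x + d *\<^sub>R J (U x)" for c d x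
    unfolding U_def rank_one_cscale \<phi>_cscale[OF rank_one_in_BG] by (simp add: cscale_def)
  have "U \<in> BG J"
  proof -
    have "bounded_linear U"
    proof (rule bounded_linear_intro[where K = 1])
      show "U (x + y) = U x + U y" for x y
        by (simp add: U_def rank_one_add \<phi>_oplus rank_one_in_BG)
      show "U (c *\<^sub>R x) = c *\<^sub>R U x" for c x using U_cscale[of c x 0] by simp
      show "norm (U x) \<le> norm x * 1" for x using U_inner[of x x] by (simp add: norm_eq_sqrt_inner)
    qed
    moreover have "U (J x) = J (U x)" for x using U_cscale[of 0 x 1] by simp
    ultimately show ?thesis by (simp add: BG_iff)
  qed
  moreover have int: "\<phi> a (U x) = U (a x)" if "a \<in> BG J" for a x
    using \<phi>_comp[OF that rank_one_in_BG] comp_rank_one[OF that] by (metis U_def)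
  moreover have "surj U"
  proof (rule surjI)
    fix h
    \<comment> \<open>Surjectivity of \<phi> supplies a preimage a of the operator taking f to h;
      since U e = f, U maps a e to h.\<close>
    have "rank_one J h f \<in> \<phi> ` BG J" using bij rank_one_in_BG by (simp add: bij_betw_def)
    then have a: "inv_into (BG J) \<phi> (rank_one J h f) \<in> BG J"
       "\<phi> (inv_into (BG J) \<phi> (rank_one J h f)) = rank_one J h f"
      by (rule inv_into_into, rule f_inv_into_f)
    have "U e = f" using pf by (simp add: U_def p_def)
    then show "U (inv_into (BG J) \<phi> (rank_one J h f) e) = h"
      using int[OF a(1), of e] a(2) rank_one_apply_unit[OF f] by simp
  qed
  ultimately show ?thesis using U_inner by (auto intro!: exI[of _ U] unitary_opI)
qed

end

section \<open>From a pairing to an isomorphism\<close>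

lemma von_neumann_algebraD:
  assumes "von_neumann_algebra J B"
  shows "B \<subseteq> BG J" "\<And>b. b \<in> B \<Longrightarrow> adj b \<in> B" "B = commutant J (commutant J B)"
  using assms by (auto simp: von_neumann_algebra_def)

lemma id_in_von_neumann_algebra: "von_neumann_algebra J B \<Longrightarrow> id \<in> B"
  using von_neumann_algebraD(3) id_in_commutant by metis

text \<open>On the zero space all operators coincide. The case is treated apart because the general
  argument compares scalars by means of a unit vector.\<close>

lemma iso_mod_trivial_space:
  fixes J :: "'a::{real_inner,complete_space} op"
  assumes triv: "\<And>x::'a. x = 0" and B: "von_neumann_algebra J B"
  shows "iso_mod J B \<theta> \<theta>' (\<lambda>s t. 1) (\<lambda>t x. x)"
proof -
  have eq: "S = T" for S T :: "'a op"
  proof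
    show "S x = T x" for x using triv[of "S x"] triv[of "T x"] by simp
  qed
  have all_B: "S \<in> B" for S
    unfolding eq[of S id] by (rule id_in_von_neumann_algebra[OF B])
  have "S \<in> BG J" for S :: "'a op" unfolding eq[of S id] by (rule id_in_BG)
  then have "S \<in> Ffib J B \<theta>' t" for S t unfolding Ffib_def using eq by blast
  with all_B have "(\<lambda>x. x) ` B = Ffib J B \<theta>' t" for t by auto
  then show ?thesis unfolding iso_mod_def by (intro conjI allI impI ballI) (rule eq | assumption)+
qed

lemma pairing_imp_iso_mod:
  fixes J :: "'a::{real_inner,complete_space} op"
  assumes J: "cstruct J" and B: "von_neumann_algebra J B"
    and pair: "paired J B \<theta> \<theta>'" and e: "norm (e::'a) = 1"
  shows "\<exists>m u. multiplier m \<and> iso_mod J B \<theta> \<theta>' m u"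
proof -
  note BD = von_neumann_algebraD[OF B]
  obtain \<alpha> where \<alpha>: "\<And>t. star_endo J (BG J) (\<alpha> t)" "\<And>t. bij_betw (\<alpha> t) (BG J) (BG J)"
      "\<And>S. S \<in> BG J \<Longrightarrow> \<alpha> 0 S = S" "\<And>s t S. S \<in> BG J \<Longrightarrow> \<alpha> (s + t) S = \<alpha> s (\<alpha> t S)"
    and \<alpha>\<theta>: "\<And>t b. 0 \<le> t \<Longrightarrow> b \<in> B \<Longrightarrow> \<alpha> (-t) b = \<theta> t b"
      "\<And>t b. 0 \<le> t \<Longrightarrow> b \<in> commutant J B \<Longrightarrow> \<alpha> t b = \<theta>' t b"
    using pair unfolding paired_def automorphism_group_def by blast
  have \<alpha>_BG: "\<alpha> t a \<in> BG J" if "a \<in> BG J" for t a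
    using \<alpha>(1)[of t] that by (simp add: star_endo_def)
  \<comment> \<open>The phase at t = 0 is normalised here, because an isomorphism must be the
    identity at time 0.\<close>
  have "\<forall>t. \<exists>U. unitary_op J U \<and> (\<forall>a\<in>BG J. \<alpha> t a \<circ> U = U \<circ> a) \<and> (t = 0 \<longrightarrow> U = id)"
  proof
    fix t show "\<exists>U. unitary_op J U \<and> (\<forall>a\<in>BG J. \<alpha> t a \<circ> U = U \<circ> a) \<and> (t = 0 \<longrightarrow> U = id)"
    proof (cases "t = 0")
      case True
      then show ?thesis using \<alpha>(3) unitary_op_id by (auto intro!: exI[of _ id])
    next
      case False
      then show ?thesis using automorphism_inner[OF J \<alpha>(1,2)[of t]] by blast
    qed
  qed
  from choice[OF this] obtain U where U: "\<And>t. unitary_op J (U t)"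
     "\<And>t a. a \<in> BG J \<Longrightarrow> \<alpha> t a \<circ> U t = U t \<circ> a" "U 0 = id" by blast
  have U_BG: "U t \<in> BG J" for t using U(1)[of t] by (simp add: unitary_op_def)
  have U_lin: "linear (U t)" for t using U_BG[of t] by (simp add: BG_iff bounded_linear.linear)
  have "\<exists>c. cmod c = 1 \<and> U (s + t) = cscale J c (U s \<circ> U t)" for s t
  proof (rule unitary_implementation_unique[OF J U(1) unitary_op_comp[OF U(1) U(1)] e U(2)])
    fix a assume a: "a \<in> BG J"
    have "\<alpha> s (\<alpha> t a) (U s (U t x)) = U s (U t (a x))" for x
      using U(2)[OF a, of t] U(2)[OF \<alpha>_BG[OF a], of s t] by (simp add: fun_eq_iff)
    then show "\<alpha> (s + t) a \<circ> (U s \<circ> U t) = U s \<circ> U t \<circ> a" using \<alpha>(4)[OF a] by (simp add: fun_eq_iff)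
  qed
  then obtain m where m: "\<And>s t. cmod (m s t) = 1" "\<And>s t. U (s + t) = cscale J (m s t) (U s \<circ> U t)"
    by metis
  have "m r s * m (r + s) t = m r (s + t) * m s t" for r s t
  \<comment> \<open>The two ways of bracketing U_{r+s+t} give the same operator as two scalar
    multiples of \<open>?W\<close>; as \<open>?W\<close> is nonzero, the scalars agree.\<close>
  proof (rule cscale_inj[OF J])
    let ?W = "U r \<circ> (U s \<circ> U t)"
    have "cscale J (m r s * m (r + s) t) ?W = cscale J (m (r + s) t) (U (r + s) \<circ> U t)"
      unfolding m(2)[of r s] cscale_comp_left cscale_cscale[OF J] by (simp add: comp_assoc mult.commute)
    also have "\<dots> = cscale J (m r (s + t)) (U r \<circ> U (s + t))"
      unfolding m(2)[symmetric] by (simp add: add.assoc)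
    also have "\<dots> = cscale J (m r (s + t) * m s t) ?W"
      unfolding m(2)[of s t] cscale_comp_right[OF U_BG] cscale_cscale[OF J] ..
    finally show "cscale J (m r s * m (r + s) t) ?W = cscale J (m r (s + t) * m s t) ?W" .
    have "norm (?W e) = 1" using norm_unitary_op[OF U(1)] e by simp
    then show "?W e \<noteq> 0" by force
  qed
  then have "multiplier m" using m(1) by (simp add: multiplier_def)
  moreover have "iso_mod J B \<theta> \<theta>' m (\<lambda>t x. U t \<circ> x)"
  proof -
    have B_bl: "bounded_linear x" if "x \<in> B" for x using BD(1) that by (auto simp: BG_iff)
    have U\<theta>: "U t (\<theta> t b x) = b (U t x)" if "0 \<le> t" "b \<in> B" for t b x
    proof -
      have b: "b \<in> BG J" using BD(1) that by blast
      \<comment> \<open>\<alpha>_t undoes \<theta>_t on B, so moving U_t past \<theta>_t(b) leaves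
        b.\<close>
      have "\<alpha> t (\<alpha> (-t) b) = b" using \<alpha>(4)[OF b, of t "-t"] \<alpha>(3)[OF b] by simp
      then show ?thesis
        using U(2)[OF \<alpha>_BG[OF b], of t "-t"] \<alpha>\<theta>(1)[OF that] by (simp add: fun_eq_iff)
    qed
    have U\<theta>': "\<theta>' t b (U t x) = U t (b x)" if "0 \<le> t" "b \<in> commutant J B" for t b x
      using U(2)[of b t] \<alpha>\<theta>(2)[OF that] that(2) commutant_subset_BG by (fastforce simp: fun_eq_iff)
    have img: "(\<lambda>x. U t \<circ> x) ` B = Ffib J B \<theta>' t" if t: "0 \<le> t" for t
    proof (intro equalityI subsetI)
      fix y assume "y \<in> (\<lambda>x. U t \<circ> x) ` B"
      then obtain x where x: "x \<in> B" "y = U t \<circ> x" by blast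
      have "b (x z) = x (b z)" if "b \<in> commutant J B" for b z
        using that x(1) by (simp add: commutant_iff)
      moreover have "U t \<circ> x \<in> BG J" using x(1) BD(1) by (intro comp_in_BG U_BG) blast
      ultimately show "y \<in> Ffib J B \<theta>' t" using U\<theta>'[OF t] x(2) by (auto simp: Ffib_def)
    next
      fix y assume y: "y \<in> Ffib J B \<theta>' t"
      have UU: "adj (U t) (U t x) = x" "U t (adj (U t) x) = x" for x
        using U(1)[of t] by (auto simp: unitary_op_def)
      have "adj (U t) (y (b x)) = b (adj (U t) (y x))" if b: "b \<in> commutant J B" for b x
      proof -
        have "y (b x) = \<theta>' t b (U t (adj (U t) (y x)))"
          using y b UU by (simp add: Ffib_def fun_eq_iff)
        also have "\<dots> = U t (b (adj (U t) (y x)))" by (rule U\<theta>'[OF t b])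
        finally show ?thesis using UU by simp
      qed
      moreover have "adj (U t) \<circ> y \<in> BG J"
        using y comp_in_BG adj_in_BG[OF J U_BG] by (auto simp: Ffib_def)
      \<comment> \<open>Composing an element of F_t with the adjoint of U_t turns it into an
        intertwiner of the identity representation of B', that is, an element of B'' = B.\<close>
      ultimately have "adj (U t) \<circ> y \<in> commutant J (commutant J B)" by (simp add: commutant_iff)
      then have "adj (U t) \<circ> y \<in> B" using BD(3) by simp
      moreover have "y = U t \<circ> (adj (U t) \<circ> y)" using UU by auto
      ultimately show "y \<in> (\<lambda>x. U t \<circ> x) ` B" by blast
    qed
    have ip: "adj (U t \<circ> x) \<circ> (U t \<circ> y) = adj x \<circ> y" if "x \<in> B" for t x y
      using adj_comp[OF unitary_op_bounded_linear[OF U(1)] B_bl[OF that]] U(1)[of t]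
      by (auto simp: unitary_op_def)
    have prod: "U (s + t) \<circ> (\<theta> t x \<circ> y) = cscale J (m s t) (U s \<circ> x \<circ> (U t \<circ> y))"
      if "0 \<le> s" "0 \<le> t" "x \<in> B" for s t x y
      unfolding m(2) cscale_comp_left
      by (rule arg_cong[where f = "cscale J (m s t)"]) (auto simp: U\<theta>[OF that(2,3)])
    have add: "U t \<circ> oplus x y = oplus (U t \<circ> x) (U t \<circ> y)" for t x y
      by (auto simp: oplus_def linear_add[OF U_lin])
    have left: "U t \<circ> (\<theta> t b \<circ> x) = b \<circ> (U t \<circ> x)" if "0 \<le> t" "b \<in> B" for t b x
      using U\<theta>[OF that] by auto
    show ?thesis
      unfolding iso_mod_def
      by (simp add: add left img ip prod cscale_comp_right[OF U_BG] U(3) comp_assoc)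
  qed
  ultimately show ?thesis by blast
qed

section \<open>From an isomorphism to a pairing\<close>

lemma star_endo_unitary_conj:
  assumes J: "cstruct J" and U: "unitary_op J U"
  shows "star_endo J (BG J) (\<lambda>a. U \<circ> a \<circ> adj U)"
proof -
  have UB: "U \<in> BG J" "adj U \<in> BG J" using U adj_in_BG[OF J] by (auto simp: unitary_op_def)
  have lin: "linear U" using UB by (simp add: BG_iff bounded_linear.linear)
  have adj_conj: "adj (U \<circ> a \<circ> adj U) = U \<circ> adj a \<circ> adj U" if "a \<in> BG J" for a
  proof -
    have bl: "bounded_linear a" "bounded_linear U" "bounded_linear (adj U)" "bounded_linear (U \<circ> a)"
      using that UB comp_in_BG[OF UB(1) that] by (auto simp: BG_iff)
    have "adj (U \<circ> a \<circ> adj U) = adj (adj U) \<circ> (adj a \<circ> adj U)"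
      unfolding adj_comp[OF bl(4,3)] adj_comp[OF bl(2,1)] ..
    then show ?thesis unfolding adj_adj[OF bl(2)] comp_assoc .
  qed
  have comp: "U \<circ> (a \<circ> b) \<circ> adj U = U \<circ> a \<circ> adj U \<circ> (U \<circ> b \<circ> adj U)" for a b
    using U by (auto simp: unitary_op_def)
  have add: "U \<circ> oplus a b \<circ> adj U = oplus (U \<circ> a \<circ> adj U) (U \<circ> b \<circ> adj U)" for a b
    by (auto simp: oplus_def linear_add[OF lin])
  have scale: "U \<circ> cscale J c a \<circ> adj U = cscale J c (U \<circ> a \<circ> adj U)" for c a
    by (simp add: cscale_comp_right[OF UB(1)] cscale_comp_left)
  have closed: "U \<circ> a \<circ> adj U \<in> BG J" if "a \<in> BG J" for a
    by (intro comp_in_BG UB that)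
  show ?thesis
    unfolding star_endo_def using closed by (intro conjI ballI allI) (simp_all only: add scale comp adj_conj)
qed

lemma bij_betw_unitary_conj:
  assumes J: "cstruct J" and U: "unitary_op J U"
  shows "bij_betw (\<lambda>a. U \<circ> a \<circ> adj U) (BG J) (BG J)"
proof (rule bij_betw_byWitness[where f' = "\<lambda>a. adj U \<circ> a \<circ> U"])
  have UB: "U \<in> BG J" "adj U \<in> BG J" using U adj_in_BG[OF J] by (auto simp: unitary_op_def)
  show "(\<lambda>a. U \<circ> a \<circ> adj U) ` BG J \<subseteq> BG J" "(\<lambda>a. adj U \<circ> a \<circ> U) ` BG J \<subseteq> BG J"
    using UB comp_in_BG by blast+
qed (use U in \<open>auto simp: unitary_op_def fun_eq_iff\<close>)

text \<open>An intertwiner into the kernel of \<open>adj U\<close>, the complement of the range of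
  U, also has its range in that of U by \<open>gen\<close>, hence is 0. The kernel is therefore
  disjoint from the identity representation and must be trivial.\<close>

lemma isometric_intertwiner_surj:
  assumes rep: "normal_rep J B \<rho>"
    and U: "U \<in> BG J" "\<And>x. adj U (U x) = x" "\<And>a x. a \<in> commutant J B \<Longrightarrow> \<rho> a (U x) = U (a x)"
    and gen: "\<And>y. y \<in> BG J \<Longrightarrow> (\<And>a. a \<in> commutant J B \<Longrightarrow> \<rho> a \<circ> y = y \<circ> a) \<Longrightarrow> range y \<subseteq> range U"
  shows "U (adj U x) = x"
proof -
  interpret normal_rep J B \<rho> by (rule rep)
  have bl: "bounded_linear U" "bounded_linear (adj U)"
    using U(1) by (auto simp: BG_iff bounded_linear_adj)
  let ?L = "{x. adj U x = 0}"
  have lin: "linear (adj U)" "linear U" using bl by (auto simp: bounded_linear.linear)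
  have "closed ?L"
    by (intro closed_Collect_eq continuous_intros linear_continuous_on bl)
  moreover have "subspace ?L" by (auto simp: subspace_def linear_0[OF lin(1)] linear_add[OF lin(1)] linear_scale[OF lin(1)])
  moreover have "adj U (\<rho> a x) = 0" if a: "a \<in> M" and x: "adj U x = 0" for a x
  proof -
    have "inner (adj U (\<rho> a x)) y = 0" for y
    proof -
      have "inner (adj U (\<rho> a x)) y = inner (\<rho> a x) (U y)" by (rule inner_adj'[OF bl(1)])
      also have "\<dots> = inner x (\<rho> (adj a) (U y))" using inner_act[OF a, of True] by (simp add: act_def)
      also have "\<dots> = inner (adj U x) (adj a y)" by (simp add: U(3)[OF adj_M[OF a]] inner_adj'[OF bl(1)])
      finally show ?thesis using x by simp
    qed
    then show ?thesis by (metis inner_eq_zero_iff)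
  qed
  moreover have "T g = 0"
    if T: "T \<in> BG J" "\<forall>a\<in>M. \<rho> a \<circ> T = T \<circ> a" "range T \<subseteq> ?L" for T g
  proof -
    have "range T \<subseteq> range U" using gen[OF T(1)] T(2) by blast
    then obtain z where z: "T g = U z" by blast
    have "adj U (T g) = 0" using T(3) by blast
    then have "z = 0" using U(2)[of z] by (simp add: z)
    with z show ?thesis by (simp add: linear_0[OF lin(2)])
  qed
  ultimately have "disjoint_on ?L" unfolding disjoint_on_def by blast
  then have "?L = {0}" by (rule disjoint_on_trivial)
  moreover have "adj U (x - U (adj U x)) = 0" by (simp add: linear_diff[OF lin(1)] U(2))
  ultimately show ?thesis by force
qed

text \<open>With \<beta>(-t) inverse to \<beta>(t), the additive law for nonnegative times extends
  to all times by writing the time of larger modulus as a sum of times of one sign.\<close>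

lemma one_parameter_group_extend:
  fixes \<beta> :: "real \<Rightarrow> 'x \<Rightarrow> 'x"
  assumes C: "\<And>t x. x \<in> C \<Longrightarrow> \<beta> t x \<in> C"
    and add: "\<And>s t x. 0 \<le> s \<Longrightarrow> 0 \<le> t \<Longrightarrow> x \<in> C \<Longrightarrow> \<beta> (s + t) x = \<beta> s (\<beta> t x)"
    and inv: "\<And>t x. x \<in> C \<Longrightarrow> \<beta> (-t) (\<beta> t x) = x"
    and x: "x \<in> C"
  shows "\<beta> (s + t) x = \<beta> s (\<beta> t x)"
proof -
  have inv2: "\<beta> t (\<beta> (-t) x) = x" if "x \<in> C" for t x using inv[OF that, of "-t"] by simp
  have pos: "\<beta> (s + t) x = \<beta> s (\<beta> t x)" if "0 \<le> s + t" "0 \<le> s \<or> 0 \<le> t" "x \<in> C" for s t x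
  proof -
    consider "0 \<le> s" "0 \<le> t" | "t < 0" | "s < 0" "0 \<le> t" by linarith
    then show ?thesis
    proof cases
      case 1
      then show ?thesis using add that by blast
    next
      case 2
      \<comment> \<open>Here s = (s + t) + (-t) with both summands nonnegative.\<close>
      then have "\<beta> s (\<beta> t x) = \<beta> (s + t) (\<beta> (-t) (\<beta> t x))"
        using add[of "s + t" "-t" "\<beta> t x"] that C by simp
      then show ?thesis using inv[OF that(3)] by simp
    next
      case 3
      then have "\<beta> t x = \<beta> (-s) (\<beta> (s + t) x)" using add[of "-s" "s + t" x] that by simp
      then show ?thesis using inv2[of "\<beta> (s + t) x" s] C that by simp
    qed
  qed
  show ?thesis
  proof (cases "0 \<le> s + t")
    case True
    then show ?thesis using pos x by (cases "0 \<le> s") auto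
  next
    case False
    \<comment> \<open>For negative s + t the opposite times have nonnegative sum; inverting their
      law gives the claim.\<close>
    have "\<beta> (-t + -s) (\<beta> s (\<beta> t x)) = \<beta> (-t) (\<beta> (-s) (\<beta> s (\<beta> t x)))"
      by (rule pos) (use False x C in auto)
    also have "\<dots> = x" using inv x C by simp
    finally have "\<beta> (- (s + t)) (\<beta> s (\<beta> t x)) = x" by (simp add: add.commute)
    then show ?thesis using inv2[of "\<beta> s (\<beta> t x)" "s + t"] x C by simp
  qed
qed

lemma iso_mod_imp_pairing:
  assumes J: "cstruct J" and B: "von_neumann_algebra J B"
    and \<theta>: "E0_semigroup J B \<theta>" and \<theta>': "E0_semigroup J (commutant J B) \<theta>'"
    and u: "iso_mod J B \<theta> \<theta>' m u"
  shows "paired J B \<theta> \<theta>'"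
proof -
  note BD = von_neumann_algebraD[OF B]
  have id: "id \<in> B" using B by (rule id_in_von_neumann_algebra)
  have u_img: "\<And>t. 0 \<le> t \<Longrightarrow> u t ` B = Ffib J B \<theta>' t"
    and u_ip: "\<And>t x y. 0 \<le> t \<Longrightarrow> x \<in> B \<Longrightarrow> y \<in> B \<Longrightarrow> adj (u t x) \<circ> u t y = adj x \<circ> y"
    and u_left: "\<And>t b x. 0 \<le> t \<Longrightarrow> b \<in> B \<Longrightarrow> x \<in> B \<Longrightarrow> u t (\<theta> t b \<circ> x) = b \<circ> u t x"
    and u_right: "\<And>t b x. 0 \<le> t \<Longrightarrow> b \<in> B \<Longrightarrow> x \<in> B \<Longrightarrow> u t (x \<circ> b) = u t x \<circ> b"
    and u_0: "\<And>x. x \<in> B \<Longrightarrow> u 0 x = x"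
    and u_prod: "\<And>s t x y. 0 \<le> s \<Longrightarrow> 0 \<le> t \<Longrightarrow> x \<in> B \<Longrightarrow> y \<in> B \<Longrightarrow>
          u (s + t) (\<theta> t x \<circ> y) = cscale J (m s t) (u s x \<circ> u t y)"
    using u by (simp_all add: iso_mod_def)
  define U where "U t = u t id" for t
  have \<theta>_B: "\<theta> t b \<in> B" if "0 \<le> t" "b \<in> B" for t b
    using \<theta> that by (simp add: E0_semigroup_def star_endo_def)
  \<comment> \<open>Right linearity makes u_t left multiplication by U_t, so the image condition on
    u_t reads F_t = U_t B.\<close>
  have u_eq: "u t x = U t \<circ> x" if "0 \<le> t" "x \<in> B" for t x
    using u_right[OF that id] by (simp add: U_def)
  have U_F: "U t \<in> Ffib J B \<theta>' t" if "0 \<le> t" for t using u_img[OF that] id by (auto simp: U_def)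
  have U_BG: "U t \<in> BG J" if "0 \<le> t" for t using U_F[OF that] by (simp add: Ffib_def)
  have U\<theta>: "U t (\<theta> t b x) = b (U t x)" if "0 \<le> t" "b \<in> B" for t b x
    using u_left[OF that id] u_eq[OF that(1) \<theta>_B[OF that]] by (simp add: U_def fun_eq_iff)
  have U\<theta>': "\<theta>' t b (U t x) = U t (b x)" if "0 \<le> t" "b \<in> commutant J B" for t b x
    using U_F[OF that(1)] that(2) by (simp add: Ffib_def fun_eq_iff)
  have iso: "adj (U t) (U t x) = x" if "0 \<le> t" for t x
    using u_ip[OF that id id] by (simp add: U_def adj_id fun_eq_iff)
  have surj: "U t (adj (U t) x) = x" if t: "0 \<le> t" for t x
  proof (rule isometric_intertwiner_surj)
    show "normal_rep J B (\<theta>' t)"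
      using J BD(1,2) \<theta>' t by unfold_locales (auto simp: E0_semigroup_def)
    show "range y \<subseteq> range (U t)"
      if "y \<in> BG J" "\<And>a. a \<in> commutant J B \<Longrightarrow> \<theta>' t a \<circ> y = y \<circ> a" for y
    proof -
      have "y \<in> u t ` B" using u_img[OF t] that by (simp add: Ffib_def)
      then show ?thesis using u_eq[OF t] by auto
    qed
  qed (use U_BG U\<theta>' iso t in auto)
  have unitary: "unitary_op J (U t)" if "0 \<le> t" for t
    using U_BG iso surj that by (simp add: unitary_op_def)
  have U_add: "U (s + t) = cscale J (m s t) (U s \<circ> U t)" if "0 \<le> s" "0 \<le> t" for s t
  proof -
    have "\<theta> t id \<circ> id = id" using \<theta> that by (simp add: E0_semigroup_def)
    then show ?thesis using u_prod[OF that id id] by (simp add: U_def)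
  qed
  \<comment> \<open>Adjoints supply negative times. V itself need not be a group; only conjugation
    by it is.\<close>
  define V where "V t = (if 0 \<le> t then U t else adj (U (- t)))" for t
  have U0: "U 0 = id" using u_0[OF id] by (simp add: U_def)
  have V_adj: "adj (V t) = V (- t)" for t
  proof (cases "t = 0")
    case True
    then show ?thesis by (simp add: V_def U0 adj_id)
  next
    case False
    then show ?thesis using adj_adj[OF BG_bounded_linear[OF U_BG[of "- t"]]] by (auto simp: V_def)
  qed
  have V: "unitary_op J (V t)" for t
    unfolding V_def using unitary unitary_op_adj[OF J] by auto
  define \<alpha> where "\<alpha> t a = V t \<circ> a \<circ> adj (V t)" for t a
  have \<alpha>_endo: "star_endo J (BG J) (\<alpha> t)" for t
    using star_endo_unitary_conj[OF J V[of t]] by (simp add: \<alpha>_def[abs_def])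
  have \<alpha>_add: "\<alpha> (s + t) a = \<alpha> s (\<alpha> t a)" if "a \<in> BG J" for s t a
  proof (rule one_parameter_group_extend[of "BG J"])
    show "\<alpha> t x \<in> BG J" if "x \<in> BG J" for t x using \<alpha>_endo[of t] that by (simp add: star_endo_def)
    show "\<alpha> (- t) (\<alpha> t x) = x" for t x
      using V[of t] V_adj[of t, symmetric] V_adj[of "-t"] by (auto simp: \<alpha>_def unitary_op_def)
    fix s t :: real and x assume st: "0 \<le> s" "0 \<le> t" and x: "x \<in> BG J"
    let ?W = "U s \<circ> U t"
    have W: "unitary_op J ?W" using unitary_op_comp unitary st by blast
    \<comment> \<open>The phase is taken out of U_{s+t} and, after x has been moved across, put back
      into it. Surjectivity of U_{s+t} then cancels this factor on the right.\<close>
    have "\<alpha> (s + t) x \<circ> U (s + t) = U (s + t) \<circ> x"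
      using iso[of "s + t"] st by (auto simp: \<alpha>_def V_def)
    also have "\<dots> = cscale J (m s t) (?W \<circ> x)" by (simp add: U_add[OF st] cscale_comp_left)
    also have "?W \<circ> x = \<alpha> s (\<alpha> t x) \<circ> ?W" using iso st by (auto simp: \<alpha>_def V_def)
    also have "cscale J (m s t) \<dots> = \<alpha> s (\<alpha> t x) \<circ> U (s + t)"
    proof -
      have "\<alpha> s (\<alpha> t x) \<in> BG J" using \<alpha>_endo x by (simp add: star_endo_def)
      then show ?thesis by (simp add: U_add[OF st] cscale_comp_right)
    qed
    finally have "\<alpha> (s + t) x (U (s + t) z) = \<alpha> s (\<alpha> t x) (U (s + t) z)" for z
      by (simp add: fun_eq_iff)
    then show "\<alpha> (s + t) x = \<alpha> s (\<alpha> t x)" using surj[of "s + t"] st by (metis add_nonneg_nonneg ext)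
  qed (rule that)
  have "automorphism_group J \<alpha>"
    unfolding automorphism_group_def
    using \<alpha>_endo \<alpha>_add bij_betw_unitary_conj[OF J V]
    by (auto simp: \<alpha>_def[abs_def] V_def U0 adj_id)
  moreover have "\<alpha> (- t) b = \<theta> t b" if "0 \<le> t" "b \<in> B" for t b
  proof
    fix x
    have "\<alpha> (- t) b x = V (- t) (b (V t x))" using V_adj[of "- t"] by (simp add: \<alpha>_def)
    also have "\<dots> = adj (U t) (b (U t x))"
      using that V_adj[of t, symmetric] by (simp add: V_def)
    also have "\<dots> = \<theta> t b x" using U\<theta>[OF that] iso[OF that(1)] by (metis)
    finally show "\<alpha> (- t) b x = \<theta> t b x" .
  qed
  moreover have "\<alpha> t b = \<theta>' t b" if "0 \<le> t" "b \<in> commutant J B" for t b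
  proof
    fix x
    have "\<alpha> t b x = U t (b (adj (U t) x))" using that by (simp add: \<alpha>_def V_def)
    also have "\<dots> = \<theta>' t b x" using U\<theta>'[OF that] surj[OF that(1)] by metis
    finally show "\<alpha> t b x = \<theta>' t b x" .
  qed
  ultimately show ?thesis unfolding paired_def by blast
qed

theorem theorem1p4:
  fixes J :: "'a::{real_inner,complete_space} \<Rightarrow> 'a"
    and B :: "('a \<Rightarrow> 'a) set"
    and \<theta> \<theta>' :: "real \<Rightarrow> ('a \<Rightarrow> 'a) \<Rightarrow> ('a \<Rightarrow> 'a)"
  assumes "cstruct J"
    and "von_neumann_algebra J B"
    and "nondegenerate B"
    and "E0_semigroup J B \<theta>"
    and "E0_semigroup J (commutant J B) \<theta>'"
  shows "paired J B \<theta> \<theta>' \<longleftrightarrow> (\<exists>m u. multiplier m \<and> iso_mod J B \<theta> \<theta>' m u)"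
proof
  assume pair: "paired J B \<theta> \<theta>'"
  show "\<exists>m u. multiplier m \<and> iso_mod J B \<theta> \<theta>' m u"
  proof (cases "\<exists>x::'a. x \<noteq> 0")
    case True
    then obtain e :: 'a where "norm e = 1" by (metis norm_sgn)
    then show ?thesis using pairing_imp_iso_mod assms(1,2) pair by blast
  next
    case False
    have "multiplier (\<lambda>s t. 1)" by (simp add: multiplier_def)
    then show ?thesis using iso_mod_trivial_space[OF _ assms(2)] False by blast
  qed
qed (use iso_mod_imp_pairing assms in blast)

end
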